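(* Let $d\ge2$, let $\mu\ge0$ be a finite measure with compact support in $\mathbb{R}^d$, and let $\lambda,\varepsilon>0$, $p\ge1$. Then $\mathcal{E}_\mu^{\lambda,\varepsilon,p}$ admits a minimizer in $\mathcal{C}$.
   Context: $\mathcal{C}$ denotes the set of curves $\varphi:[0,a]\to\mathbb{R}^d$, $a\ge 0$, that are Lipschitz with $|\varphi'|=1$ a.e.; the length $L(\varphi)$ is its total variation, which equals $a$. $\Gamma_\varphi$ is the image of $\varphi$, $d(x,\Gamma)=\inf_{y\in\Gamma}|x-y|$, and $\kappa_\varphi=\varphi''$. The functional is $\mathcal{E}_\mu^{\lambda,\varepsilon,p}(\varphi)=\int d(x,\Gamma_\varphi)^p\,d\mu+\lambda L(\varphi)+\varepsilon\int_0^{L(\varphi)}|\kappa_\varphi|^2dt$ if $\varphi\in H^2([0,L(\varphi)];\mathbb{R}^d)\cap\mathcal{C}$ and $+\infty$ otherwise (a single-point curve has curvature term $0$). *)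

theory Defs
  imports "HOL-Analysis.Analysis" "HOL-Probability.Probability"
begin

text \<open>A curve is a pair (a, phi) with a \<ge> 0; only the restriction of phi to [0,a] matters.\<close>

definition arc_curves :: "(real \<times> (real \<Rightarrow> 'a::euclidean_space)) set" where
  "arc_curves = {(a, \<phi>). a \<ge> 0 \<and> (\<exists>C. C-lipschitz_on {0..a} \<phi>) \<and>
      (AE t in lborel. t \<in> {0..a} \<longrightarrow>
          (\<exists>v. (\<phi> has_vector_derivative v) (at t within {0..a}) \<and> norm v = 1))}"

definition curve_length :: "real \<times> (real \<Rightarrow> 'a::euclidean_space) \<Rightarrow> real" where
  "curve_length c = fst c"

definition curve_image :: "real \<times> (real \<Rightarrow> 'a::euclidean_space) \<Rightarrow> 'a set" where
  "curve_image c = snd c ` {0..fst c}"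

text \<open>kappa is a (weak) second derivative of phi on [0,a] in L^2: phi is C^1 with
  derivative psi, and psi is absolutely continuous with derivative kappa in L^2.
  This is exactly membership of phi in H^2([0,a]) with phi'' = kappa a.e.\<close>

definition weak_second_deriv :: "real \<Rightarrow> (real \<Rightarrow> 'a::euclidean_space) \<Rightarrow> (real \<Rightarrow> 'a) \<Rightarrow> bool" where
  "weak_second_deriv a \<phi> \<kappa> \<longleftrightarrow>
     \<kappa> absolutely_integrable_on {0..a} \<and>
     (\<lambda>t. (norm (\<kappa> t))\<^sup>2) integrable_on {0..a} \<and>
     (\<exists>\<psi>. \<forall>t\<in>{0..a}. \<psi> t = \<psi> 0 + integral {0..t} \<kappa> \<and>
                      \<phi> t = \<phi> 0 + integral {0..t} \<psi>)"

definition in_H2 :: "real \<times> (real \<Rightarrow> 'a::euclidean_space) \<Rightarrow> bool" where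
  "in_H2 c \<longleftrightarrow> (\<exists>\<kappa>. weak_second_deriv (fst c) (snd c) \<kappa>)"

definition curvature :: "real \<times> (real \<Rightarrow> 'a::euclidean_space) \<Rightarrow> real \<Rightarrow> 'a" where
  "curvature c = (SOME \<kappa>. weak_second_deriv (fst c) (snd c) \<kappa>)"

definition curve_energy ::
  "'a::euclidean_space measure \<Rightarrow> real \<Rightarrow> real \<Rightarrow> real \<Rightarrow> real \<times> (real \<Rightarrow> 'a) \<Rightarrow> ennreal" where
  "curve_energy \<mu> lam \<epsilon> p c =
     (if c \<in> arc_curves \<and> in_H2 c then
        (\<integral>\<^sup>+ x. ennreal (infdist x (curve_image c) powr p) \<partial>\<mu>)
        + ennreal (lam * curve_length c)
        + ennreal (\<epsilon> * integral {0..curve_length c} (\<lambda>t. (norm (curvature c t))\<^sup>2))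
      else \<top>)"

end

theory Submission
  imports Defs "HOL-Complex_Analysis.Great_Picard"
begin

text \<open>
  Direct method. Along a minimizing sequence the lengths and the squared \<open>L\<^sup>2\<close> norms of the
  curvatures are bounded by the energy, and the starting points are bounded because \<open>\<mu>\<close> has compact
  support (if \<open>\<mu> = 0\<close> a point curve has energy zero). Extending the curvatures by zero
  to a common interval \<open>[0,A]\<close> extends each curve by a tangent segment, so all tangents are unit
  vectors on \<open>[0,A]\<close>; they are equicontinuous, and by Arzela--Ascoli they converge uniformly along a
  subsequence. The limit tangent is the primitive of some \<open>h\<close> in \<open>L\<^sup>2\<close> with
  \<open>\<parallel>h\<parallel>\<^sup>2\<close> at most the limit of the squared norms: the sets of \<open>L\<^sup>2\<close> functions whose primitives
  are \<open>1/(n+1)\<close>-close to the limit are nested and convex, and near-minimizers of the norm in them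
  converge strongly. The distance term is lower semicontinuous by Fatou's lemma.
\<close>

section \<open>Square-integrable functions on finite measure spaces\<close>

definition square_integrable :: "'c measure \<Rightarrow> ('c \<Rightarrow> 'b::euclidean_space) \<Rightarrow> bool" where
  "square_integrable M f \<longleftrightarrow> f \<in> borel_measurable M \<and> integrable M (\<lambda>x. (norm (f x))\<^sup>2)"

text \<open>The parallelogram law solved for the difference. Dropping the midpoint term dominates
  \<open>(norm (x - y))\<^sup>2\<close>, which makes differences square integrable; bounding that
  term from below forces near-minimizers over a midpoint-convex set close together.\<close>

lemma parallelogram_midpoint:
  fixes x y :: "'b::real_inner"
  shows "(norm (x - y))\<^sup>2 = 2 * (norm x)\<^sup>2 + 2 * (norm y)\<^sup>2 - 4 * (norm ((1/2) *\<^sub>R (x + y)))\<^sup>2"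
  unfolding power2_norm_eq_inner
  by (simp add: inner_add_left inner_add_right inner_diff_left inner_diff_right inner_commute field_simps)

lemma square_integrable_scaleR:
  assumes "square_integrable M f"
  shows "square_integrable M (\<lambda>x. c *\<^sub>R f x)"
  using assms unfolding square_integrable_def by (auto simp: power_mult_distrib)

lemma square_integrable_diff:
  assumes "square_integrable M f" "square_integrable M g"
  shows "square_integrable M (\<lambda>x. f x - g x)"
proof -
  have [measurable]: "f \<in> borel_measurable M" "g \<in> borel_measurable M"
    using assms unfolding square_integrable_def by auto
  have "integrable M (\<lambda>x. 2 * (norm (f x))\<^sup>2 + 2 * (norm (g x))\<^sup>2)"
    using assms unfolding square_integrable_def by auto
  then have "integrable M (\<lambda>x. (norm (f x - g x))\<^sup>2)"
    proof (rule Bochner_Integration.integrable_bound)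
    show "AE x in M. norm ((norm (f x - g x))\<^sup>2) \<le> norm (2 * (norm (f x))\<^sup>2 + 2 * (norm (g x))\<^sup>2)"
    proof (rule AE_I2)
      fix x
      show "norm ((norm (f x - g x))\<^sup>2) \<le> norm (2 * (norm (f x))\<^sup>2 + 2 * (norm (g x))\<^sup>2)"
        using parallelogram_midpoint[of "f x" "g x"] zero_le_power2[of "norm ((1/2) *\<^sub>R (f x + g x))"]
          zero_le_power2[of "norm (f x - g x)"]
        unfolding real_norm_def by linarith
    qed
  qed measurable
  then show ?thesis
    unfolding square_integrable_def by auto
qed

lemma square_integrable_add:
  assumes "square_integrable M f" "square_integrable M g"
  shows "square_integrable M (\<lambda>x. f x + g x)"
  using square_integrable_diff[OF assms(1) square_integrable_scaleR[OF assms(2), of "-1"]] by simp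

text \<open>The weighted inequality \<open>2r \<le> c + r\<^sup>2/c\<close> with a free parameter \<open>c\<close> replaces the
  Cauchy--Schwarz inequality throughout.\<close>

lemma (in finite_measure) square_integrable_imp_integrable:
  assumes "square_integrable M f"
  shows "integrable M f"
    and "c > 0 \<Longrightarrow> (\<integral>x. norm (f x) \<partial>M) \<le> (c * measure M (space M) + (\<integral>x. (norm (f x))\<^sup>2 \<partial>M) / c) / 2"
proof -
  have [measurable]: "f \<in> borel_measurable M" and i: "integrable M (\<lambda>x. (norm (f x))\<^sup>2)"
    using assms unfolding square_integrable_def by auto
  have le: "r \<le> (c + r\<^sup>2 / c) / 2" if "c > 0" for c r :: real
  proof -
    have "0 \<le> (r - c)\<^sup>2 / c" using that by simp
    then show ?thesis using that by (simp add: power2_eq_square field_simps)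
  qed
  have bi: "integrable M (\<lambda>x. (c + (norm (f x))\<^sup>2 / c) / 2)" for c
    using i by simp
  show int: "integrable M f"
    by (rule Bochner_Integration.integrable_bound[OF bi[of 1]]) (use le[of 1] in \<open>auto intro!: order_trans[OF le[of 1]]\<close>)
  show "(\<integral>x. norm (f x) \<partial>M) \<le> (c * measure M (space M) + (\<integral>x. (norm (f x))\<^sup>2 \<partial>M) / c) / 2" if "c > 0"
  proof -
    have "(\<integral>x. norm (f x) \<partial>M) \<le> (\<integral>x. (c + (norm (f x))\<^sup>2 / c) / 2 \<partial>M)"
      by (intro integral_mono bi integrable_norm int le that)
    also have "\<dots> = (c * measure M (space M) + (\<integral>x. (norm (f x))\<^sup>2 \<partial>M) / c) / 2"
      using i by (simp add: mult.commute)
    finally show ?thesis .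
  qed
qed

text \<open>Fatou's lemma transferred to Bochner integrals: it is applied to the
  \<open>ennreal\<close> integrals, where the finite bound also yields integrability of the limit.
  The varying bound \<open>C n\<close> accommodates approximate minimizers.\<close>

lemma integral_Fatou_bound:
  fixes f :: "nat \<Rightarrow> 'c \<Rightarrow> real"
  assumes "\<And>n. integrable M (f n)" "\<And>n x. 0 \<le> f n x" "g \<in> borel_measurable M"
    and "AE x in M. (\<lambda>n. f n x) \<longlonglongrightarrow> g x"
    and "\<forall>\<^sub>F n in sequentially. (\<integral>x. f n x \<partial>M) \<le> C n" "C \<longlonglongrightarrow> c"
  shows "integrable M g" "(\<integral>x. g x \<partial>M) \<le> c"
proof -
  have g0: "AE x in M. 0 \<le> g x"
    using assms(4) by eventually_elim (rule LIMSEQ_le_const, use assms(2) in auto)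
  have [measurable]: "\<And>n. f n \<in> borel_measurable M" "g \<in> borel_measurable M"
    using assms by auto
  \<comment> \<open>\<open>ennreal\<close> sends negative reals to 0, so the return to real numbers
    at the end uses this sign.\<close>
  have "c \<ge> 0"
  proof (rule tendsto_lowerbound[OF assms(6)])
    show "\<forall>\<^sub>F n in sequentially. 0 \<le> C n"
      using assms(5) by eventually_elim (rule order_trans[OF integral_nonneg_AE], use assms(2) in auto)
  qed auto
  have "(\<integral>\<^sup>+x. ennreal (g x) \<partial>M) = (\<integral>\<^sup>+x. liminf (\<lambda>n. ennreal (f n x)) \<partial>M)"
  proof (rule nn_integral_cong_AE)
    show "AE x in M. ennreal (g x) = liminf (\<lambda>n. ennreal (f n x))"
      using assms(4) by eventually_elim (auto intro!: lim_imp_Liminf[symmetric] tendsto_ennrealI)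
  qed
  also have "\<dots> \<le> liminf (\<lambda>n. \<integral>\<^sup>+x. ennreal (f n x) \<partial>M)"
    by (rule nn_integral_liminf) auto
  also have "\<dots> \<le> liminf (\<lambda>n. ennreal (C n))"
  proof (rule Liminf_mono)
    show "\<forall>\<^sub>F n in sequentially. (\<integral>\<^sup>+x. ennreal (f n x) \<partial>M) \<le> ennreal (C n)"
      using assms(5) by eventually_elim
        (use assms(1,2) in \<open>auto simp: nn_integral_eq_integral intro!: ennreal_leI\<close>)
  qed
  also have "\<dots> = ennreal c"
    by (rule lim_imp_Liminf) (auto intro!: tendsto_ennrealI assms)
  finally have *: "(\<integral>\<^sup>+x. ennreal (g x) \<partial>M) \<le> ennreal c" .
  show "integrable M g"
    by (rule integrableI_nonneg) (use g0 * in \<open>auto simp: less_top[symmetric] top_unique\<close>)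
  then have "ennreal (\<integral>x. g x \<partial>M) \<le> ennreal c"
    using * g0 by (simp add: nn_integral_eq_integral)
  then show "(\<integral>x. g x \<partial>M) \<le> c"
    using \<open>c \<ge> 0\<close> by simp
qed

text \<open>Completeness of L^2, reached through L^1: on a finite measure space a sequence that is
  Cauchy in L^2 is Cauchy in L^1, so a subsequence converges almost everywhere, and Fatou's lemma
  bounds the limit. Convergence is stated in L^1 because that norm controls primitives.\<close>

lemma (in finite_measure) square_integrable_Cauchy_limit:
  fixes g :: "nat \<Rightarrow> 'a \<Rightarrow> 'b::euclidean_space"
  assumes g: "\<And>n. square_integrable M (g n)"
    and cauchy: "\<And>e. e > 0 \<Longrightarrow> \<exists>N. \<forall>m\<ge>N. \<forall>n\<ge>N. (\<integral>x. (norm (g m x - g n x))\<^sup>2 \<partial>M) \<le> e"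
    and bound: "\<And>n. (\<integral>x. (norm (g n x))\<^sup>2 \<partial>M) \<le> C n" "C \<longlonglongrightarrow> c"
  obtains h where "square_integrable M h" "(\<integral>x. (norm (h x))\<^sup>2 \<partial>M) \<le> c"
    "(\<lambda>n. \<integral>x. norm (g n x - h x) \<partial>M) \<longlonglongrightarrow> 0"
proof -
  have [measurable]: "\<And>n. g n \<in> borel_measurable M"
    using g unfolding square_integrable_def by auto
  have gi: "integrable M (g n)" for n by (rule square_integrable_imp_integrable[OF g])
  have L1: "\<exists>N. \<forall>m\<ge>N. \<forall>n\<ge>N. (\<integral>x. norm (g m x - g n x) \<partial>M) < e" if "e > 0" for e
  proof -
    \<comment> \<open>With squared distances at most \<open>c * c\<close> the weighted inequality
      gives \<open>c * (measure M (space M) + 1) / 2 = e / 2\<close>; the added 1 keeps the divisor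
      positive.\<close>
    define c where "c = e / (measure M (space M) + 1)"
    have pos: "measure M (space M) + 1 > 0" by (simp add: add_nonneg_pos)
    have c: "c > 0" using that pos by (simp add: c_def)
    obtain N where N: "\<And>m n. m \<ge> N \<Longrightarrow> n \<ge> N \<Longrightarrow> (\<integral>x. (norm (g m x - g n x))\<^sup>2 \<partial>M) \<le> c * c"
      using cauchy[of "c * c"] c by auto
    have "(\<integral>x. norm (g m x - g n x) \<partial>M) < e" if "m \<ge> N" "n \<ge> N" for m n
    proof -
      have "(\<integral>x. norm (g m x - g n x) \<partial>M)
          \<le> (c * measure M (space M) + (\<integral>x. (norm (g m x - g n x))\<^sup>2 \<partial>M) / c) / 2"
        by (rule square_integrable_imp_integrable(2)[OF square_integrable_diff[OF g g] c])
      also have "\<dots> \<le> (c * measure M (space M) + (c * c) / c) / 2"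
        using N[OF that] c by (intro divide_right_mono add_left_mono) auto
      also have "\<dots> = c * (measure M (space M) + 1) / 2"
        using c by (simp add: field_simps)
      also have "\<dots> = e / 2" using pos by (simp add: c_def)
      also have "\<dots> < e" using \<open>e > 0\<close> by simp
      finally show ?thesis .
    qed
    then show ?thesis by blast
  qed
  obtain r where r: "strict_mono r" and ae: "AE x in M. Cauchy (\<lambda>i. g (r i) x)"
    using cauchy_L1_AE_cauchy_subseq[OF gi L1] by blast
  define h where "h x = lim (\<lambda>i. g (r i) x)" for x
  have [measurable]: "h \<in> borel_measurable M"
    unfolding h_def by measurable
  have conv: "AE x in M. (\<lambda>i. g (r i) x) \<longlonglongrightarrow> h x"
    using ae by eventually_elim (simp add: h_def Cauchy_convergent convergent_LIMSEQ_iff[symmetric])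
  have sq: "integrable M (\<lambda>x. (norm (g (r n) x))\<^sup>2)" for n
    using g unfolding square_integrable_def by auto
  have convsq: "AE x in M. (\<lambda>i. (norm (g (r i) x))\<^sup>2) \<longlonglongrightarrow> (norm (h x))\<^sup>2"
    using conv by eventually_elim (intro tendsto_intros)
  have Cr: "(\<lambda>n. C (r n)) \<longlonglongrightarrow> c"
    using LIMSEQ_subseq_LIMSEQ[OF bound(2) r] by (simp add: o_def)
  have h: "integrable M (\<lambda>x. (norm (h x))\<^sup>2)" "(\<integral>x. (norm (h x))\<^sup>2 \<partial>M) \<le> c"
    using integral_Fatou_bound[of M "\<lambda>n x. (norm (g (r n) x))\<^sup>2" "\<lambda>x. (norm (h x))\<^sup>2", OF sq _ _ convsq _ Cr]
      bound(1) by auto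
  have "\<exists>N. \<forall>n\<ge>N. (\<integral>x. norm (g n x - h x) \<partial>M) < e" if "e > 0" for e
  proof -
    obtain N where N: "\<And>m n. m \<ge> N \<Longrightarrow> n \<ge> N \<Longrightarrow> (\<integral>x. norm (g m x - g n x) \<partial>M) < e / 2"
      using L1[of "e/2"] \<open>e > 0\<close> half_gt_zero by blast
    \<comment> \<open>Fatou's lemma in \<open>m\<close> along the subsequence turns the Cauchy
      estimate into an estimate against \<open>h\<close> for every large \<open>n\<close>, not only
      for indices in the subsequence.\<close>
    have "(\<integral>x. norm (g n x - h x) \<partial>M) \<le> e / 2" if n: "n \<ge> N" for n
    proof (rule integral_Fatou_bound(2))
      show "integrable M (\<lambda>x. norm (g n x - g (r m) x))" for m using gi by auto
      show "AE x in M. (\<lambda>m. norm (g n x - g (r m) x)) \<longlonglongrightarrow> norm (g n x - h x)"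
        using conv by eventually_elim (intro tendsto_intros)
      show "\<forall>\<^sub>F m in sequentially. (\<integral>x. norm (g n x - g (r m) x) \<partial>M) \<le> e / 2"
        using eventually_ge_at_top[of N]
      proof eventually_elim
        case (elim m)
        then have "r m \<ge> N" using seq_suble[OF r, of m] by linarith
        then show ?case using N[OF n] by (simp add: less_imp_le)
      qed
    qed auto
    then show ?thesis using \<open>e > 0\<close> by (intro exI[of _ N]) force
  qed
  then have "(\<lambda>n. \<integral>x. norm (g n x - h x) \<partial>M) \<longlonglongrightarrow> 0"
    by (intro LIMSEQ_I) auto
  then show ?thesis
    using that[of h] h unfolding square_integrable_def by auto
qed

text \<open>Near-minimizers of the norm over the sets \<open>T n\<close> form a Cauchy sequence by the parallelogram law.
  This plays the role of weak sequential compactness of balls in \<open>L\<^sup>2\<close>.\<close>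

lemma (in finite_measure) nested_midpoint_convex_limit:
  fixes T :: "nat \<Rightarrow> ('a \<Rightarrow> 'b::euclidean_space) set"
  assumes sq: "\<And>n f. f \<in> T n \<Longrightarrow> square_integrable M f"
    and dec: "\<And>m n. m \<le> n \<Longrightarrow> T n \<subseteq> T m"
    and mid: "\<And>n f g. f \<in> T n \<Longrightarrow> g \<in> T n \<Longrightarrow> (\<lambda>x. (1/2) *\<^sub>R (f x + g x)) \<in> T n"
    and k: "\<And>n. \<forall>\<^sub>F m in sequentially. k m \<in> T n"
    and c: "(\<lambda>m. \<integral>x. (norm (k m x))\<^sup>2 \<partial>M) \<longlonglongrightarrow> c"
  obtains g h where "\<And>n. g n \<in> T n" "square_integrable M h" "(\<integral>x. (norm (h x))\<^sup>2 \<partial>M) \<le> c"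
    "(\<lambda>n. \<integral>x. norm (g n x - h x) \<partial>M) \<longlonglongrightarrow> 0"
proof -
  define J where "J f = (\<integral>x. (norm (f x))\<^sup>2 \<partial>M)" for f :: "'a \<Rightarrow> 'b"
  \<comment> \<open>The sets shrink, so these infima increase; \<open>k m\<close> lies eventually in
    each \<open>T n\<close>, so they stay below \<open>c\<close> and converge.\<close>
  define d where "d n = Inf (J ` T n)" for n
  have J0: "0 \<le> J f" for f unfolding J_def by simp
  have bdd: "bdd_below (J ` T n)" for n by (rule bdd_belowI[of _ 0]) (auto simp: J0)
  have ne: "T n \<noteq> {}" for n using eventually_happens[OF k[of n]] by auto
  have dle: "d n \<le> J f" if "f \<in> T n" for n f
    unfolding d_def by (rule cInf_lower) (use that bdd in auto)
  have dc: "d n \<le> c" for n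
  proof (rule tendsto_lowerbound[OF c])
    show "\<forall>\<^sub>F m in sequentially. d n \<le> (\<integral>x. (norm (k m x))\<^sup>2 \<partial>M)"
      using k[of n] by eventually_elim (use dle J_def in auto)
  qed auto
  have incd: "incseq d"
    unfolding incseq_def d_def by (auto intro!: cInf_superset_mono bdd image_mono dec simp: ne)
  obtain D where D: "d \<longlonglongrightarrow> D" "\<And>n. d n \<le> D"
    using incseq_convergent[OF incd] dc by blast
  have "\<exists>g\<in>T n. J g < d n + 1 / real (Suc n)" for n
    using cInf_lessD[of "J ` T n" "d n + 1 / real (Suc n)"] ne unfolding d_def[symmetric] by auto
  then obtain g where gT: "\<And>n. g n \<in> T n" and gJ: "\<And>n. J (g n) < d n + 1 / real (Suc n)"
    by metis
  have inv: "(\<lambda>n. 1 / real (Suc n)) \<longlonglongrightarrow> 0"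
    using LIMSEQ_inverse_real_of_nat by (simp add: inverse_eq_divide)
  have C: "(\<lambda>n. d n + 1 / real (Suc n)) \<longlonglongrightarrow> D"
    using tendsto_add[OF D(1) inv] by simp
  have cauchy: "\<exists>N. \<forall>m\<ge>N. \<forall>n\<ge>N. (\<integral>x. (norm (g m x - g n x))\<^sup>2 \<partial>M) \<le> e" if "e > 0" for e
  proof -
    \<comment> \<open>This quantity bounds the squared distance of two near-minimizers of index at
      least \<open>N\<close>: each has squared norm at most \<open>D + 1 / real (Suc N)\<close>,
      while their midpoint lies in \<open>T N\<close> and has squared norm at least
      \<open>d N\<close>.\<close>
    have "(\<lambda>N. 4 * (D + 1 / real (Suc N) - d N)) \<longlonglongrightarrow> 4 * (D + 0 - D)"
      by (intro tendsto_intros D inv)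
    then have "\<forall>\<^sub>F N in sequentially. 4 * (D + 1 / real (Suc N) - d N) < e"
      using that by (auto elim: order_tendstoD(2))
    then obtain N where N: "4 * (D + 1 / real (Suc N) - d N) < e"
      using eventually_happens by force
    have "(\<integral>x. (norm (g m x - g n x))\<^sup>2 \<partial>M) \<le> e" if m: "m \<ge> N" and n: "n \<ge> N" for m n
    proof -
      let ?f = "\<lambda>x. (1/2) *\<^sub>R (g m x + g n x)"
      have fT: "?f \<in> T N" using mid gT dec m n by blast
      have i: "integrable M (\<lambda>x. (norm (g m x))\<^sup>2)" "integrable M (\<lambda>x. (norm (g n x))\<^sup>2)"
        "integrable M (\<lambda>x. (norm (?f x))\<^sup>2)"
        using sq[OF gT] sq[OF fT] unfolding square_integrable_def by blast+
      have eq: "(\<integral>x. (norm (g m x - g n x))\<^sup>2 \<partial>M) = 2 * J (g m) + 2 * J (g n) - 4 * J ?f"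
        unfolding J_def parallelogram_midpoint using i by (simp del: norm_scaleR)
      have "J (g l) \<le> D + 1 / real (Suc N)" if "l \<ge> N" for l
        using gJ[of l] D(2)[of l] that frac_le[of 1 1 "real (Suc N)" "real (Suc l)"] by simp
      from this[OF m] this[OF n] eq show ?thesis using dle[OF fT] N unfolding right_diff_distrib distrib_left by linarith
    qed
    then show ?thesis by blast
  qed
  have "J (g n) \<le> d n + 1 / real (Suc n)" for n using gJ[of n] by simp
  then obtain h where "square_integrable M h" "(\<integral>x. (norm (h x))\<^sup>2 \<partial>M) \<le> D"
    "(\<lambda>n. \<integral>x. norm (g n x - h x) \<partial>M) \<longlonglongrightarrow> 0"
    using square_integrable_Cauchy_limit[of g, OF sq[OF gT] cauchy _ C] unfolding J_def by blast
  moreover have "D \<le> c" using LIMSEQ_le_const2[OF D(1)] dc by blast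
  ultimately show ?thesis using that[of g h] gT by force
qed

section \<open>Square-integrable functions on intervals and compactness of their primitives\<close>

text \<open>Dictionary between the measure-theoretic notion, for which limits are taken, and the
  gauge-integral conditions that occur in \<open>weak_second_deriv\<close>.\<close>

lemma square_integrable_lebesgue_on_iff:
  fixes k :: "real \<Rightarrow> 'b::euclidean_space"
  shows "square_integrable (lebesgue_on {a..b}) k \<longleftrightarrow>
    k absolutely_integrable_on {a..b} \<and> (\<lambda>t. (norm (k t))\<^sup>2) integrable_on {a..b}"
    (is "?l \<longleftrightarrow> ?r")
proof
  interpret finite_measure "lebesgue_on {a..b}"
    by (rule finite_measure_lebesgue_on) simp
  assume ?l
  then have "integrable (lebesgue_on {a..b}) k" "integrable (lebesgue_on {a..b}) (\<lambda>t. (norm (k t))\<^sup>2)"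
    using square_integrable_imp_integrable(1) by (auto simp: square_integrable_def)
  then show ?r
    by (auto simp: integrable_restrict_space set_integrable_def integrable_on_lebesgue_on)
next
  assume r: ?r
  then have "(\<lambda>t. (norm (k t))\<^sup>2) absolutely_integrable_on {a..b}"
    by (subst absolutely_integrable_on_iff_nonneg) auto
  moreover have "k \<in> borel_measurable (lebesgue_on {a..b})"
    using r absolutely_integrable_measurable[of "{a..b}" k] by simp
  ultimately show ?l
    by (auto simp: square_integrable_def integrable_restrict_space set_integrable_def)
qed

lemma square_integrable_subinterval:
  fixes k :: "real \<Rightarrow> 'b::euclidean_space"
  assumes "square_integrable (lebesgue_on {a..b}) k" "{s..t} \<subseteq> {a..b}"
  shows "square_integrable (lebesgue_on {s..t}) k"
    and "integral {s..t} (\<lambda>x. (norm (k x))\<^sup>2) \<le> integral {a..b} (\<lambda>x. (norm (k x))\<^sup>2)"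
proof -
  have k: "k absolutely_integrable_on {a..b}" "(\<lambda>t. (norm (k t))\<^sup>2) integrable_on {a..b}"
    using assms(1) by (auto simp: square_integrable_lebesgue_on_iff)
  have k2: "(\<lambda>t. (norm (k t))\<^sup>2) integrable_on {s..t}"
    by (rule integrable_on_subinterval[OF k(2) assms(2)])
  have "k absolutely_integrable_on {s..t}"
    by (rule set_integrable_subset[OF k(1) _ assms(2)]) simp
  with k2 show "square_integrable (lebesgue_on {s..t}) k"
    by (simp add: square_integrable_lebesgue_on_iff)
  show "integral {s..t} (\<lambda>x. (norm (k x))\<^sup>2) \<le> integral {a..b} (\<lambda>x. (norm (k x))\<^sup>2)"
    by (rule integral_subset_le[OF assms(2) k2 k(2)]) simp
qed

lemma norm_integral_le_square:
  fixes k :: "real \<Rightarrow> 'b::euclidean_space"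
  assumes k: "square_integrable (lebesgue_on {s..t}) k" and "s \<le> t" "c > 0"
  shows "norm (integral {s..t} k) \<le> (c * (t - s) + integral {s..t} (\<lambda>x. (norm (k x))\<^sup>2) / c) / 2"
proof -
  interpret finite_measure "lebesgue_on {s..t}"
    by (rule finite_measure_lebesgue_on) simp
  have i: "integrable (lebesgue_on {s..t}) k" "integrable (lebesgue_on {s..t}) (\<lambda>x. (norm (k x))\<^sup>2)"
    using k square_integrable_imp_integrable(1) by (auto simp: square_integrable_def)
  have "norm (integral {s..t} k) \<le> (\<integral>x. norm (k x) \<partial>lebesgue_on {s..t})"
    using integral_norm_bound[of "lebesgue_on {s..t}" k] by (simp add: lebesgue_integral_eq_integral i)
  also have "\<dots> \<le> (c * (t - s) + integral {s..t} (\<lambda>x. (norm (k x))\<^sup>2) / c) / 2"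
    using square_integrable_imp_integrable(2)[OF k \<open>c > 0\<close>] \<open>s \<le> t\<close>
    by (simp add: lebesgue_integral_eq_integral i measure_restrict_space)
  finally show ?thesis .
qed

text \<open>Equicontinuity of primitives, with constants depending only on \<open>B\<close>.
  Optimizing over \<open>c\<close> would give the Hoelder bound
  \<open>sqrt (B * \<bar>s - t\<bar>)\<close>; keeping \<open>c\<close> free serves the same
  purpose.\<close>

lemma primitive_increment_le:
  fixes k :: "real \<Rightarrow> 'b::euclidean_space"
  assumes k: "square_integrable (lebesgue_on {0..A}) k"
    and B: "integral {0..A} (\<lambda>x. (norm (k x))\<^sup>2) \<le> B"
    and st: "s \<in> {0..A}" "t \<in> {0..A}" and "c > 0"
  shows "norm (integral {0..s} k - integral {0..t} k) \<le> (c * \<bar>s - t\<bar> + B / c) / 2"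
proof -
  have main: "norm (integral {0..t} k - integral {0..s} k) \<le> (c * (t - s) + B / c) / 2"
    if "0 \<le> s" "s \<le> t" "t \<le> A" for s t
  proof -
    have sub: "{s..t} \<subseteq> {0..A}" using that by auto
    have "k integrable_on {0..t}"
      using k that by (auto simp: square_integrable_lebesgue_on_iff absolutely_integrable_on_def
          intro: integrable_on_subinterval)
    then have "integral {0..s} k + integral {s..t} k = integral {0..t} k"
      using that by (intro Henstock_Kurzweil_Integration.integral_combine) auto
    then have "integral {0..t} k - integral {0..s} k = integral {s..t} k"
      by (simp add: algebra_simps)
    also have "norm \<dots> \<le> (c * (t - s) + integral {s..t} (\<lambda>x. (norm (k x))\<^sup>2) / c) / 2"
      using norm_integral_le_square[OF square_integrable_subinterval(1)[OF k sub]] that \<open>c > 0\<close> by auto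
    also have "\<dots> \<le> (c * (t - s) + B / c) / 2"
      using square_integrable_subinterval(2)[OF k sub] B \<open>c > 0\<close>
      by (intro divide_right_mono add_left_mono) auto
    finally show ?thesis .
  qed
  show ?thesis
  proof (cases "s \<le> t")
    case True
    then show ?thesis using main[of s t] st by (simp add: norm_minus_commute)
  next
    case False
    then show ?thesis using main[of t s] st by simp
  qed
qed

text \<open>Taking primitives is linear and balls are convex; this supplies the midpoint hypothesis
  of \<open>nested_midpoint_convex_limit\<close>.\<close>

lemma primitive_midpoint_close:
  fixes f g :: "real \<Rightarrow> 'b::euclidean_space"
  assumes "f integrable_on {0..t}" "g integrable_on {0..t}"
    and "norm (integral {0..t} f - u) \<le> e" "norm (integral {0..t} g - u) \<le> e"
  shows "norm (integral {0..t} (\<lambda>x. (1/2) *\<^sub>R (f x + g x)) - u) \<le> e"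
proof -
  have "integral {0..t} (\<lambda>x. (1/2) *\<^sub>R (f x + g x)) - u
      = (1/2) *\<^sub>R ((integral {0..t} f - u) + (integral {0..t} g - u))"
    using assms(1,2) by (simp add: Henstock_Kurzweil_Integration.integral_add algebra_simps
        scaleR_add_left[symmetric] integrable_add del: scaleR_add_right)
  then show ?thesis
    using norm_triangle_ineq[of "integral {0..t} f - u" "integral {0..t} g - u"] assms(3,4) by simp
qed

text \<open>The bound does not depend on \<open>t\<close>, so L^1 convergence of functions gives
  uniform convergence of their primitives.\<close>

lemma primitive_diff_le:
  fixes f g :: "real \<Rightarrow> 'b::euclidean_space"
  assumes f: "integrable (lebesgue_on {0..A}) f" and g: "integrable (lebesgue_on {0..A}) g" and t: "t \<in> {0..A}"
  shows "norm (integral {0..t} f - integral {0..t} g) \<le> (\<integral>x. norm (f x - g x) \<partial>lebesgue_on {0..A})"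
proof -
  have sub: "{0..t} \<subseteq> {0..A}" using t by auto
  have int: "f integrable_on {0..t}" "g integrable_on {0..t}"
    using integrable_on_subinterval[OF integrable_on_lebesgue_on sub] f g by auto
  have ni: "integrable (lebesgue_on {0..A}) (\<lambda>x. norm (f x - g x))" using f g by simp
  then have nA: "(\<lambda>x. norm (f x - g x)) integrable_on {0..A}"
    by (rule integrable_on_lebesgue_on) simp
  then have nt: "(\<lambda>x. norm (f x - g x)) integrable_on {0..t}"
    by (rule integrable_on_subinterval[OF _ sub])
  have "norm (integral {0..t} f - integral {0..t} g) = norm (integral {0..t} (\<lambda>x. f x - g x))"
    using int by (simp add: Henstock_Kurzweil_Integration.integral_diff)
  also have "\<dots> \<le> integral {0..t} (\<lambda>x. norm (f x - g x))"
    by (rule integral_norm_bound_integral) (use int nt in \<open>auto intro: integrable_diff\<close>)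
  also have "\<dots> \<le> integral {0..A} (\<lambda>x. norm (f x - g x))"
    by (rule integral_subset_le[OF sub nt nA]) simp
  finally show ?thesis by (simp add: lebesgue_integral_eq_integral[OF ni])
qed

text \<open>Uniform convergence of primitives takes the place of weak L^2 convergence, and the bound
  by \<open>K\<close> is the weak lower semicontinuity of the norm. Arzela--Ascoli yields the
  uniform limit \<open>g\<close>; the nested sets \<open>T n\<close> then show that \<open>g\<close>
  is a primitive of some \<open>h\<close> within that bound.\<close>

lemma square_integrable_primitives_compact:
  fixes k :: "nat \<Rightarrow> real \<Rightarrow> 'b::euclidean_space"
  assumes k: "\<And>n. square_integrable (lebesgue_on {0..A}) (k n)"
    and lim: "(\<lambda>n. integral {0..A} (\<lambda>x. (norm (k n x))\<^sup>2)) \<longlonglongrightarrow> K"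
  obtains r h where "strict_mono (r :: nat \<Rightarrow> nat)" "square_integrable (lebesgue_on {0..A}) h"
    "integral {0..A} (\<lambda>x. (norm (h x))\<^sup>2) \<le> K"
    "\<And>e. e > 0 \<Longrightarrow> \<forall>\<^sub>F n in sequentially. \<forall>t\<in>{0..A}. norm (integral {0..t} (k (r n)) - integral {0..t} h) < e"
proof -
  interpret finite_measure "lebesgue_on {0..A}"
    by (rule finite_measure_lebesgue_on) simp
  obtain B where B: "B > 0" and kB: "\<And>n. integral {0..A} (\<lambda>x. (norm (k n x))\<^sup>2) \<le> B"
    using convergent_imp_Bseq[OF convergentI[OF lim]] unfolding Bseq_def by auto (meson abs_le_D1)
  obtain g r where r: "strict_mono (r :: nat \<Rightarrow> nat)"
    and g: "\<And>e. 0 < e \<Longrightarrow> \<exists>N. \<forall>n t. n \<ge> N \<and> t \<in> {0..A} \<longrightarrow> norm (integral {0..t} (k (r n)) - g t) < e"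
  proof (rule Arzela_Ascoli[of "{0..A}" "\<lambda>n t. integral {0..t} (k n)" "(A + B) / 2"])
    \<comment> \<open>The increment bound from the point 0, taken with \<open>c = 1\<close>.\<close>
    show "norm (integral {0..t} (k n)) \<le> (A + B) / 2" if "t \<in> {0..A}" for n t
      using primitive_increment_le[OF k kB that, of 0 1 n] that by simp
    show "\<exists>d>0. \<forall>n t. t \<in> {0..A} \<and> norm (s - t) < d \<longrightarrow> norm (integral {0..s} (k n) - integral {0..t} (k n)) < e"
      if s: "s \<in> {0..A}" and e: "0 < e" for s e
    proof -
      \<comment> \<open>This choice makes \<open>B / c = e\<close>, and
        \<open>\<bar>s - t\<bar> < e / c\<close> makes the other term smaller than \<open>e\<close>;
        their mean is then below \<open>e\<close>.\<close>
      define c where "c = B / e"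
      have c: "c > 0" using B e by (simp add: c_def)
      have "norm (integral {0..s} (k n) - integral {0..t} (k n)) < e"
        if "t \<in> {0..A}" "norm (s - t) < e / c" for n t
      proof -
        have "c * \<bar>s - t\<bar> < e" using that(2) c by (simp add: field_simps)
        then have "(c * \<bar>s - t\<bar> + B / c) / 2 < (e + e) / 2"
          using B e by (intro divide_strict_right_mono add_less_le_mono) (auto simp: c_def)
        then show ?thesis using primitive_increment_le[OF k kB s that(1) c, of n] by simp
      qed
      then show ?thesis using c e by (intro exI[of _ "e / c"]) auto
    qed
  qed auto
  define T where "T n = {f. square_integrable (lebesgue_on {0..A}) f \<and>
     (\<forall>t\<in>{0..A}. norm (integral {0..t} f - g t) \<le> 1 / real (Suc n))}" for n :: nat
  have int: "f integrable_on {0..t}" if "square_integrable (lebesgue_on {0..A}) f" "t \<in> {0..A}"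
    for f :: "real \<Rightarrow> 'b" and t
    using square_integrable_subinterval(1)[OF that(1), of 0 t] that(2)
    by (auto simp: square_integrable_lebesgue_on_iff absolutely_integrable_on_def)
  obtain f h where fT: "\<And>n. f n \<in> T n" and h: "square_integrable (lebesgue_on {0..A}) h"
    "(\<integral>x. (norm (h x))\<^sup>2 \<partial>lebesgue_on {0..A}) \<le> K"
    and fh: "(\<lambda>n. \<integral>x. norm (f n x - h x) \<partial>lebesgue_on {0..A}) \<longlonglongrightarrow> 0"
  proof (rule nested_midpoint_convex_limit[of T "\<lambda>n. k (r n)" K])
    show "square_integrable (lebesgue_on {0..A}) f" if "f \<in> T n" for n f
      using that by (simp add: T_def)
    show "T n \<subseteq> T m" if "m \<le> n" for m n
      using frac_le[of 1 1 "real (Suc m)" "real (Suc n)"] that unfolding T_def by fastforce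
    show "(\<lambda>x. (1/2) *\<^sub>R (u x + v x)) \<in> T n" if u: "u \<in> T n" and v: "v \<in> T n" for n u v
    proof -
      have "square_integrable (lebesgue_on {0..A}) (\<lambda>x. (1/2) *\<^sub>R (u x + v x))"
        using u v by (intro square_integrable_scaleR square_integrable_add) (auto simp: T_def)
      moreover have "norm (integral {0..t} (\<lambda>x. (1/2) *\<^sub>R (u x + v x)) - g t) \<le> 1 / real (Suc n)"
        if "t \<in> {0..A}" for t
        by (rule primitive_midpoint_close) (use u v that int in \<open>auto simp: T_def\<close>)
      ultimately show ?thesis unfolding T_def by blast
    qed
    show "\<forall>\<^sub>F m in sequentially. k (r m) \<in> T n" for n
    proof -
      obtain N where "\<forall>m t. m \<ge> N \<and> t \<in> {0..A} \<longrightarrow> norm (integral {0..t} (k (r m)) - g t) < 1 / real (Suc n)"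
        using g[of "1 / real (Suc n)"] by auto
      then have "k (r m) \<in> T n" if "m \<ge> N" for m
        using that k unfolding T_def by (auto intro: less_imp_le)
      then show ?thesis unfolding eventually_sequentially by blast
    qed
    have "integrable (lebesgue_on {0..A}) (\<lambda>x. (norm (k m x))\<^sup>2)" for m
      using k by (simp add: square_integrable_def)
    then show "(\<lambda>m. \<integral>x. (norm (k (r m) x))\<^sup>2 \<partial>lebesgue_on {0..A}) \<longlonglongrightarrow> K"
      using LIMSEQ_subseq_LIMSEQ[OF lim r] by (simp add: o_def lebesgue_integral_eq_integral)
  qed blast
  \<comment> \<open>Two errors vanish: the L^1 distance from \<open>f n\<close> to \<open>h\<close>,
    and the closeness \<open>1 / real (Suc n)\<close> built into \<open>T n\<close>.\<close>
  have hg: "integral {0..t} h = g t" if t: "t \<in> {0..A}" for t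
  proof -
    have "norm (integral {0..t} h - g t) \<le> (\<integral>x. norm (f n x - h x) \<partial>lebesgue_on {0..A}) + 1 / real (Suc n)" for n
    proof -
      have sq: "square_integrable (lebesgue_on {0..A}) (f n)" and close: "norm (integral {0..t} (f n) - g t) \<le> 1 / real (Suc n)"
        using fT[of n] t by (auto simp: T_def)
      have "norm (integral {0..t} (f n) - integral {0..t} h) \<le> (\<integral>x. norm (f n x - h x) \<partial>lebesgue_on {0..A})"
        by (rule primitive_diff_le) (use sq h(1) square_integrable_imp_integrable(1) t in auto)
      then show ?thesis
        using close norm_triangle_ineq[of "integral {0..t} h - integral {0..t} (f n)" "integral {0..t} (f n) - g t"]
        by (simp add: norm_minus_commute)
    qed
    moreover have "(\<lambda>n. (\<integral>x. norm (f n x - h x) \<partial>lebesgue_on {0..A}) + 1 / real (Suc n)) \<longlonglongrightarrow> 0 + 0"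
      using LIMSEQ_inverse_real_of_nat by (intro tendsto_add fh) (simp add: inverse_eq_divide)
    ultimately have "norm (integral {0..t} h - g t) \<le> 0"
      by (metis (no_types, lifting) LIMSEQ_le_const add_0)
    then show ?thesis by simp
  qed
  show ?thesis
  proof (rule that[OF r h(1)])
    show "integral {0..A} (\<lambda>x. (norm (h x))\<^sup>2) \<le> K"
      using h by (simp add: square_integrable_def lebesgue_integral_eq_integral)
    show "\<forall>\<^sub>F n in sequentially. \<forall>t\<in>{0..A}. norm (integral {0..t} (k (r n)) - integral {0..t} h) < e"
      if e: "e > 0" for e
    proof -
      obtain N where "\<forall>n t. n \<ge> N \<and> t \<in> {0..A} \<longrightarrow> norm (integral {0..t} (k (r n)) - g t) < e"
        using g[OF e] by blast
      then show ?thesis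
        unfolding eventually_sequentially by (intro exI[of _ N]) (simp add: hg)
    qed
  qed
qed

section \<open>Curves, their tangents and their curvature\<close>

text \<open>By Lebesgue differentiation the integrand is almost everywhere the limit of its right
  averages, and these are differences of values of the vanishing primitive.\<close>

lemma primitive_zero_imp_negligible:
  fixes f :: "real \<Rightarrow> 'b::euclidean_space"
  assumes f: "f absolutely_integrable_on {0..a}" and z: "\<And>t. t \<in> {0..a} \<Longrightarrow> integral {0..t} f = 0"
  shows "negligible {t \<in> {0..a}. f t \<noteq> 0}"
proof -
  \<comment> \<open>Extension by zero provides integrability on every box, as the differentiation
    theorem requires.\<close>
  define F where "F t = (if t \<in> {0..a} then f t else 0)" for t
  have "F absolutely_integrable_on UNIV"
    unfolding F_def by (simp only: absolutely_integrable_restrict_UNIV f)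
  then have "F absolutely_integrable_on cbox s t" for s t
    by (rule set_integrable_subset) auto
  then have "F integrable_on cbox s t" for s t
    by (simp add: absolutely_integrable_on_def)
  then obtain N where N: "negligible N"
    and D: "\<And>x e. \<lbrakk>x \<notin> N; 0 < e\<rbrakk> \<Longrightarrow>
      \<exists>d>0. \<forall>h. 0 < h \<and> h < d \<longrightarrow> norm (integral (cbox x (x + h *\<^sub>R One)) F /\<^sub>R h ^ DIM(real) - F x) < e"
    using integrable_ccontinuous_explicit[of F] by blast
  have "f x = 0" if x: "x \<in> {0..a}" "x \<notin> N" "x \<noteq> a" for x
  proof (rule ccontr)
    assume "f x \<noteq> 0"
    then obtain d where d: "d > 0" "\<And>h. 0 < h \<Longrightarrow> h < d \<Longrightarrow> norm (integral {x..x+h} F /\<^sub>R h - F x) < norm (f x)"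
      using D[OF x(2), of "norm (f x)"] by (auto simp: cbox_interval)
    \<comment> \<open>The step stays inside the differentiation window and inside
      \<open>[0,a]\<close>; it is positive because \<open>x\<close> is not the right
      endpoint.\<close>
    define h where "h = min (d / 2) (a - x)"
    have h: "0 < h" "h < d" "x + h \<le> a" using d(1) x by (auto simp: h_def min_def)
    have fi: "f integrable_on {0..x+h}"
      by (rule integrable_on_subinterval[of f "{0..a}"]) (use f h in \<open>auto simp: absolutely_integrable_on_def\<close>)
    have "integral {x..x+h} F = integral {x..x+h} f"
      by (rule integral_cong) (use h x in \<open>auto simp: F_def\<close>)
    also have "\<dots> = integral {0..x+h} f - integral {0..x} f"
      using Henstock_Kurzweil_Integration.integral_combine[OF _ _ fi, of x] x h by (simp add: algebra_simps)
    also have "\<dots> = 0" using z[of "x+h"] z[of x] x h by simp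
    finally show False using d(2)[OF h(1,2)] x by (simp add: F_def)
  qed
  then have "{t \<in> {0..a}. f t \<noteq> 0} \<subseteq> N \<union> {a}" by blast
  then show ?thesis using N by (meson negligible_Un negligible_sing negligible_subset)
qed

text \<open>On \<open>[0,a]\<close> the function \<open>\<psi>\<close> is a constant plus the
  primitive of an integrable function, hence continuous, so the fundamental theorem of calculus
  holds at every point.\<close>

lemma weak_second_deriv_tangent:
  fixes \<phi> :: "real \<Rightarrow> 'b::euclidean_space"
  assumes "weak_second_deriv a \<phi> \<kappa>"
  obtains \<psi> where "continuous_on {0..a} \<psi>"
    "\<And>t. t \<in> {0..a} \<Longrightarrow> \<psi> t = \<psi> 0 + integral {0..t} \<kappa>"
    "\<And>t. t \<in> {0..a} \<Longrightarrow> \<phi> t = \<phi> 0 + integral {0..t} \<psi>"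
    "\<And>t. t \<in> {0..a} \<Longrightarrow> (\<phi> has_vector_derivative \<psi> t) (at t within {0..a})"
proof -
  obtain \<psi> where \<psi>: "\<And>t. t \<in> {0..a} \<Longrightarrow> \<psi> t = \<psi> 0 + integral {0..t} \<kappa>"
    "\<And>t. t \<in> {0..a} \<Longrightarrow> \<phi> t = \<phi> 0 + integral {0..t} \<psi>"
    using assms unfolding weak_second_deriv_def by blast
  have "\<kappa> integrable_on {0..a}"
    using assms by (auto simp: weak_second_deriv_def absolutely_integrable_on_def)
  then have "continuous_on {0..a} (\<lambda>t. \<psi> 0 + integral {0..t} \<kappa>)"
    by (intro continuous_intros indefinite_integral_continuous_1)
  then have c: "continuous_on {0..a} \<psi>"
    by (rule continuous_on_eq) (rule \<psi>(1)[symmetric])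
  have "(\<phi> has_vector_derivative \<psi> t) (at t within {0..a})" if t: "t \<in> {0..a}" for t
  proof (rule has_vector_derivative_transform[OF t])
    show "((\<lambda>t. \<phi> 0 + integral {0..t} \<psi>) has_vector_derivative \<psi> t) (at t within {0..a})"
      using has_vector_derivative_add[OF has_vector_derivative_const integral_has_vector_derivative[OF c t]]
      by simp
  qed (rule \<psi>(2))
  then show ?thesis using that[OF c \<psi>] by presburger
qed

text \<open>Makes the curvature term independent of the representative that \<open>SOME\<close>
  picks in \<open>curvature\<close>. The derivative of \<open>\<phi>\<close> determines the tangent,
  so both candidates have the same primitive and differ only on a negligible set.\<close>

lemma weak_second_deriv_square_integral_unique:
  fixes \<phi> :: "real \<Rightarrow> 'b::euclidean_space"
  assumes 1: "weak_second_deriv a \<phi> \<kappa>" and 2: "weak_second_deriv a \<phi> \<kappa>'"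
  shows "integral {0..a} (\<lambda>t. (norm (\<kappa> t))\<^sup>2) = integral {0..a} (\<lambda>t. (norm (\<kappa>' t))\<^sup>2)"
\<comment> \<open>On a one-point interval derivatives are not unique, but there, as on an empty one,
  both integrals are 0.\<close>
proof (cases "a > 0")
  case True
  obtain \<psi> where \<psi>: "\<And>t. t \<in> {0..a} \<Longrightarrow> \<psi> t = \<psi> 0 + integral {0..t} \<kappa>"
    "\<And>t. t \<in> {0..a} \<Longrightarrow> (\<phi> has_vector_derivative \<psi> t) (at t within {0..a})"
    using weak_second_deriv_tangent[OF 1] by metis
  obtain \<psi>' where \<psi>': "\<And>t. t \<in> {0..a} \<Longrightarrow> \<psi>' t = \<psi>' 0 + integral {0..t} \<kappa>'"
    "\<And>t. t \<in> {0..a} \<Longrightarrow> (\<phi> has_vector_derivative \<psi>' t) (at t within {0..a})"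
    using weak_second_deriv_tangent[OF 2] by metis
  have eq: "\<psi> t = \<psi>' t" if "t \<in> {0..a}" for t
    using vector_derivative_unique_within_closed_interval[of 0 a t \<phi> "\<psi> t" "\<psi>' t"] True that \<psi>(2) \<psi>'(2)
    by (simp add: cbox_interval)
  have ai: "\<kappa> absolutely_integrable_on {0..a}" "\<kappa>' absolutely_integrable_on {0..a}"
    using 1 2 by (auto simp: weak_second_deriv_def)
  have "integral {0..t} (\<lambda>t. \<kappa> t - \<kappa>' t) = 0" if t: "t \<in> {0..a}" for t
  proof -
    have "\<kappa> integrable_on {0..t}" "\<kappa>' integrable_on {0..t}"
      using ai t by (auto simp: absolutely_integrable_on_def intro: integrable_on_subinterval)
    then show ?thesis
      using \<psi>(1)[OF t] \<psi>'(1)[OF t] eq[OF t] eq[of 0] True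
      by (simp add: Henstock_Kurzweil_Integration.integral_diff)
  qed
  then have neg: "negligible {t \<in> {0..a}. \<kappa> t - \<kappa>' t \<noteq> 0}"
    using ai by (intro primitive_zero_imp_negligible set_integral_diff)
  show ?thesis
    by (rule integral_spike[OF neg]) auto
next
  case False
  then show ?thesis by (cases "a = 0") auto
qed

text \<open>Unit speed holds almost everywhere by definition; the tangent is continuous, and a
  nonnegative continuous function with integral 0 vanishes everywhere.\<close>

lemma weak_second_deriv_norm_tangent:
  fixes \<phi> :: "real \<Rightarrow> 'b::euclidean_space"
  assumes "(a, \<phi>) \<in> arc_curves" "a > 0" and c: "continuous_on {0..a} \<psi>"
    and d: "\<And>t. t \<in> {0..a} \<Longrightarrow> (\<phi> has_vector_derivative \<psi> t) (at t within {0..a})"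
    and t: "t \<in> {0..a}"
  shows "norm (\<psi> t) = 1"
proof -
  have "AE t in lborel. t \<in> {0..a} \<longrightarrow> (\<exists>v. (\<phi> has_vector_derivative v) (at t within {0..a}) \<and> norm v = 1)"
    using assms(1) by (auto simp: arc_curves_def)
  then have "AE t in lborel. t \<in> {0..a} \<longrightarrow> norm (\<psi> t) = 1"
  proof eventually_elim
    case (elim t)
    then show ?case
      using vector_derivative_unique_within_closed_interval[of 0 a t \<phi> "\<psi> t"] \<open>a > 0\<close> d
      by (auto simp: cbox_interval)
  qed
  then obtain N where N: "{t. \<not> (t \<in> {0..a} \<longrightarrow> norm (\<psi> t) = 1)} \<subseteq> N" "N \<in> null_sets lborel"
    by (rule AE_E) (auto simp: null_sets_def)
  then have neg: "negligible N"
    by (simp add: negligible_iff_null_sets null_sets_completionI)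
  have "integral {0..a} (\<lambda>t. \<bar>norm (\<psi> t) - 1\<bar>) = integral {0..a} (\<lambda>t. 0)"
    by (rule integral_spike[OF neg]) (use N(1) in auto)
  moreover have "continuous_on {0..a} (\<lambda>t. \<bar>norm (\<psi> t) - 1\<bar>)"
    by (intro continuous_intros c)
  ultimately have "\<bar>norm (\<psi> t) - 1\<bar> = 0"
    using integral_eq_0_iff[of 0 a "\<lambda>t. \<bar>norm (\<psi> t) - 1\<bar>"] \<open>a > 0\<close> t by auto
  then show ?thesis by simp
qed

text \<open>Puts curves of different lengths on one interval without changing the curvature term:
  beyond the end of the curve the curvature is 0, so the tangent keeps its last, unit,
  value.\<close>

lemma arc_curve_extension:
  fixes c :: "real \<times> (real \<Rightarrow> 'b::euclidean_space)"
  assumes c: "c \<in> arc_curves" "in_H2 c" and A: "fst c \<le> A"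
  obtains v k where "square_integrable (lebesgue_on {0..A}) k"
    "integral {0..A} (\<lambda>t. (norm (k t))\<^sup>2) = integral {0..fst c} (\<lambda>t. (norm (curvature c t))\<^sup>2)"
    "\<And>t. t \<in> {0..A} \<Longrightarrow> norm (v + integral {0..t} k) = 1"
    "\<And>t. t \<in> {0..fst c} \<Longrightarrow> snd c t = snd c 0 + integral {0..t} (\<lambda>s. v + integral {0..s} k)"
proof -
  obtain a \<phi> where ca: "c = (a, \<phi>)" by (cases c)
  define \<kappa> where "\<kappa> = curvature c"
  have w: "weak_second_deriv a \<phi> \<kappa>"
    using c(2) someI_ex[of "weak_second_deriv a \<phi>"] unfolding \<kappa>_def curvature_def in_H2_def ca by simp
  have a: "0 \<le> a" using c(1) by (auto simp: ca arc_curves_def)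
  have \<kappa>: "\<kappa> absolutely_integrable_on {0..a}" "(\<lambda>t. (norm (\<kappa> t))\<^sup>2) integrable_on {0..a}"
    using w by (auto simp: weak_second_deriv_def)
  obtain \<psi> where cont: "continuous_on {0..a} \<psi>"
    and \<psi>: "\<And>t. t \<in> {0..a} \<Longrightarrow> \<psi> t = \<psi> 0 + integral {0..t} \<kappa>"
    and \<phi>: "\<And>t. t \<in> {0..a} \<Longrightarrow> \<phi> t = \<phi> 0 + integral {0..t} \<psi>"
    and deriv: "\<And>t. t \<in> {0..a} \<Longrightarrow> (\<phi> has_vector_derivative \<psi> t) (at t within {0..a})"
    using weak_second_deriv_tangent[OF w] by metis
  obtain b :: 'b where b: "b \<in> Basis" using nonempty_Basis by blast
  \<comment> \<open>For a point curve \<open>\<psi> 0\<close> carries no information, so an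
    arbitrary unit vector serves as direction.\<close>
  define v where "v = (if a > 0 then \<psi> 0 else b)"
  define k where "k t = (if t \<in> {0..a} then \<kappa> t else 0)" for t
  have k2: "(norm (k t))\<^sup>2 = (if t \<in> {0..a} then (norm (\<kappa> t))\<^sup>2 else 0)" for t
    by (simp add: k_def)
  have kint: "integral {0..t} k = integral {0..min t a} \<kappa>" for t
  proof -
    have "integral {0..t} k = integral ({0..a} \<inter> {0..t}) \<kappa>"
      unfolding k_def by (rule Henstock_Kurzweil_Integration.integral_restrict_Int)
    also have "{0..a} \<inter> {0..t} = {0..min t a}" by auto
    finally show ?thesis .
  qed
  have tangent: "v + integral {0..t} k = \<psi> (min t a)" if "a > 0" "0 \<le> t" for t
    using \<psi>[of "min t a"] that a by (simp add: kint v_def)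
  show ?thesis
  proof (rule that[of k v])
    have "k absolutely_integrable_on UNIV"
      unfolding k_def by (simp only: absolutely_integrable_restrict_UNIV \<kappa>(1))
    then have "k absolutely_integrable_on {0..A}"
      by (rule set_integrable_subset) auto
    moreover have "(\<lambda>t. (norm (k t))\<^sup>2) integrable_on {0..A}"
    proof -
      have "(\<lambda>t. (norm (k t))\<^sup>2) integrable_on {0..a}"
        using \<kappa>(2) by (rule integrable_eq) (simp add: k_def)
      then show ?thesis
        by (rule integrable_on_superset) (use A in \<open>auto simp: k_def ca\<close>)
    qed
    ultimately show "square_integrable (lebesgue_on {0..A}) k"
      by (simp add: square_integrable_lebesgue_on_iff)
    have "{0..a} \<inter> {0..A} = {0..a}" using A by (auto simp: ca)
    then have "integral {0..A} (\<lambda>t. (norm (k t))\<^sup>2) = integral {0..a} (\<lambda>t. (norm (\<kappa> t))\<^sup>2)"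
      unfolding k2 by (simp only: Henstock_Kurzweil_Integration.integral_restrict_Int)
    then show "integral {0..A} (\<lambda>t. (norm (k t))\<^sup>2) = integral {0..fst c} (\<lambda>t. (norm (curvature c t))\<^sup>2)"
      by (simp only: \<kappa>_def ca fst_conv)
    show "norm (v + integral {0..t} k) = 1" if t: "t \<in> {0..A}" for t
    proof (cases "a > 0")
      case True
      then show ?thesis
        using tangent[of t] t weak_second_deriv_norm_tangent[of a \<phi> \<psi> "min t a"] c(1) cont deriv
        by (auto simp: ca)
    next
      case False
      then have "{0..min t a} \<subseteq> {0}" by auto
      then have "integral {0..min t a} \<kappa> = 0"
        by (metis integral_empty integral_singleton subset_singletonD)
      then show ?thesis using False b by (simp add: kint v_def)
    qed
    show "snd c t = snd c 0 + integral {0..t} (\<lambda>s. v + integral {0..s} k)" if t: "t \<in> {0..fst c}" for t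
    proof (cases "a > 0")
      case True
      have "integral {0..t} (\<lambda>s. v + integral {0..s} k) = integral {0..t} \<psi>"
        by (rule integral_cong) (use tangent[OF True] t in \<open>auto simp: ca\<close>)
      then show ?thesis using \<phi>[of t] t by (simp add: ca)
    next
      case False
      then have "t = 0" using t a by (auto simp: ca)
      then show ?thesis by simp
    qed
  qed
qed

text \<open>The converse construction: a starting point, an initial tangent and a curvature
  determine an admissible curve, provided that the resulting tangents are unit vectors. Uniqueness
  of the curvature term identifies its energy.\<close>

lemma arc_curve_of_curvature:
  fixes \<kappa> :: "real \<Rightarrow> 'b::euclidean_space" and v x :: 'b
  assumes a: "a \<ge> 0" and \<kappa>: "square_integrable (lebesgue_on {0..a}) \<kappa>"
    and unit: "\<And>t. t \<in> {0..a} \<Longrightarrow> norm (v + integral {0..t} \<kappa>) = 1"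
  defines "c \<equiv> (a, \<lambda>t. x + integral {0..t} (\<lambda>s. v + integral {0..s} \<kappa>))"
  shows "c \<in> arc_curves" "in_H2 c"
    "integral {0..a} (\<lambda>t. (norm (curvature c t))\<^sup>2) = integral {0..a} (\<lambda>t. (norm (\<kappa> t))\<^sup>2)"
    "1-lipschitz_on {0..a} (snd c)"
proof -
  define \<phi> where "\<phi> = (\<lambda>t. x + integral {0..t} (\<lambda>s. v + integral {0..s} \<kappa>))"
  have ca: "c = (a, \<phi>)" by (simp add: c_def \<phi>_def)
  have w: "weak_second_deriv a \<phi> \<kappa>"
    using \<kappa> unfolding weak_second_deriv_def square_integrable_lebesgue_on_iff
    by (intro conjI exI[of _ "\<lambda>t. v + integral {0..t} \<kappa>"]) (auto simp: \<phi>_def)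
  then show "in_H2 c" by (auto simp: in_H2_def ca)
  have "weak_second_deriv a \<phi> (curvature c)"
    unfolding curvature_def ca fst_conv snd_conv by (rule someI[of "weak_second_deriv a \<phi>", OF w])
  then show "integral {0..a} (\<lambda>t. (norm (curvature c t))\<^sup>2) = integral {0..a} (\<lambda>t. (norm (\<kappa> t))\<^sup>2)"
    by (rule weak_second_deriv_square_integral_unique[OF _ w])
  have "\<kappa> integrable_on {0..a}"
    using w by (auto simp: weak_second_deriv_def absolutely_integrable_on_def)
  then have cont: "continuous_on {0..a} (\<lambda>t. v + integral {0..t} \<kappa>)"
    by (intro continuous_intros indefinite_integral_continuous_1)
  have deriv: "(\<phi> has_vector_derivative (v + integral {0..t} \<kappa>)) (at t within {0..a})" if t: "t \<in> {0..a}" for t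
    using has_vector_derivative_add[OF has_vector_derivative_const integral_has_vector_derivative[OF cont t]]
    by (simp add: \<phi>_def)
  have lip: "1-lipschitz_on {0..a} \<phi>"
  proof (rule bounded_derivative_imp_lipschitz)
    show "(\<phi> has_derivative (\<lambda>h. h *\<^sub>R (v + integral {0..t} \<kappa>))) (at t within {0..a})" if "t \<in> {0..a}" for t
      using deriv[OF that] by (simp add: has_vector_derivative_def)
    show "onorm (\<lambda>h::real. h *\<^sub>R (v + integral {0..t} \<kappa>)) \<le> 1" if "t \<in> {0..a}" for t
      by (rule onorm_bound) (use unit[OF that] in auto)
  qed auto
  then show "1-lipschitz_on {0..a} (snd c)" by (simp add: ca)
  show "c \<in> arc_curves"
    unfolding arc_curves_def ca using a lip deriv unit by blast
qed

text \<open>The definition of \<open>arc_curves\<close> gives only some Lipschitz constant;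
  rebuilding the curve from its own curvature gives the constant 1.\<close>

lemma arc_curve_lipschitz:
  assumes "c \<in> arc_curves" "in_H2 c"
  shows "1-lipschitz_on {0..fst c} (snd c)"
proof -
  obtain v k where k: "square_integrable (lebesgue_on {0..fst c}) k"
    "\<And>t. t \<in> {0..fst c} \<Longrightarrow> norm (v + integral {0..t} k) = 1"
    and eq: "\<And>t. t \<in> {0..fst c} \<Longrightarrow> snd c t = snd c 0 + integral {0..t} (\<lambda>s. v + integral {0..s} k)"
    using arc_curve_extension[OF assms order_refl] by metis
  have "fst c \<ge> 0" using assms(1) by (auto simp: arc_curves_def)
  from arc_curve_of_curvature(4)[OF this k]
  have "1-lipschitz_on {0..fst c} (\<lambda>t. snd c 0 + integral {0..t} (\<lambda>s. v + integral {0..s} k))"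
    unfolding snd_conv .
  then show ?thesis
    by (rule lipschitz_on_transform) (rule eq)
qed

section \<open>Lower semicontinuity of the energy\<close>

text \<open>Each point \<open>g t\<close> is compared with \<open>f (min t a)\<close>: closeness of
  the two maps costs \<open>d\<close>, and moving the parameter back to \<open>a\<close> costs at
  most \<open>\<bar>a - b\<bar>\<close> by the Lipschitz bound.\<close>

lemma infdist_image_perturb:
  fixes f g :: "real \<Rightarrow> 'b::euclidean_space"
  assumes f: "1-lipschitz_on {0..A} f" and close: "\<And>t. t \<in> {0..A} \<Longrightarrow> dist (f t) (g t) \<le> d"
    and a: "0 \<le> a" "a \<le> A" and b: "0 \<le> b" "b \<le> A"
  shows "infdist x (f ` {0..a}) \<le> infdist x (g ` {0..b}) + (d + \<bar>a - b\<bar>)"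
proof -
  have "infdist x (f ` {0..a}) - (d + \<bar>a - b\<bar>) \<le> dist x (g t)" if t: "t \<in> {0..b}" for t
  proof -
    define s where "s = min t a"
    have s: "s \<in> {0..a}" "\<bar>s - t\<bar> \<le> \<bar>a - b\<bar>" using t a by (auto simp: s_def)
    have "infdist x (f ` {0..a}) \<le> dist x (f s)" using s by (intro infdist_le) auto
    also have "\<dots> \<le> dist x (g t) + dist (f t) (g t) + dist (f s) (f t)"
      using dist_triangle[of x "f s" "g t"] dist_triangle[of "g t" "f s" "f t"]
      by (simp add: dist_commute)
    also have "dist (f t) (g t) \<le> d" using close t b by auto
    also have "dist (f s) (f t) \<le> \<bar>s - t\<bar>"
      using lipschitz_onD[OF f, of s t] s t a b by (auto simp: dist_real_def)
    finally show ?thesis using s(2) by linarith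
  qed
  then have "infdist x (f ` {0..a}) - (d + \<bar>a - b\<bar>) \<le> infdist x (g ` {0..b})"
    using b(1) by (auto simp: infdist_def intro!: cINF_greatest)
  then show ?thesis by linarith
qed

text \<open>Fatou's lemma along \<open>e = 1 / real (Suc n)\<close> removes the slack left by the
  perturbation estimate. The truncation at 0 keeps the base of \<open>powr\<close>
  nonnegative.\<close>

lemma nn_integral_infdist_powr_limit:
  fixes S :: "'a::euclidean_space set"
  assumes \<mu>: "sets \<mu> = sets borel" and p: "p > 0"
    and bound: "\<And>e. e > 0 \<Longrightarrow> (\<integral>\<^sup>+ x. ennreal (max 0 (infdist x S - e) powr p) \<partial>\<mu>) \<le> C"
  shows "(\<integral>\<^sup>+ x. ennreal (infdist x S powr p) \<partial>\<mu>) \<le> C"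
proof -
  have inv: "(\<lambda>n. 1 / real (Suc n)) \<longlonglongrightarrow> 0"
    using LIMSEQ_inverse_real_of_nat by (simp add: inverse_eq_divide)
  have lim: "(\<lambda>n. ennreal (max 0 (infdist x S - 1 / real (Suc n)) powr p)) \<longlonglongrightarrow> ennreal (infdist x S powr p)" for x
  proof (rule tendsto_ennrealI)
    have "(\<lambda>n. max 0 (infdist x S - 1 / real (Suc n))) \<longlonglongrightarrow> max 0 (infdist x S - 0)"
      by (intro tendsto_intros inv)
    then have "(\<lambda>n. max 0 (infdist x S - 1 / real (Suc n))) \<longlonglongrightarrow> infdist x S"
      by (simp add: infdist_nonneg)
    then show "(\<lambda>n. max 0 (infdist x S - 1 / real (Suc n)) powr p) \<longlonglongrightarrow> infdist x S powr p"
      \<comment> \<open>The limit of the bases may be 0; continuity of \<open>powr\<close> there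
        relies on \<open>p > 0\<close>.\<close>
      by (rule tendsto_powr2) (use p in auto)
  qed
  have [measurable]: "(\<lambda>x. infdist x S) \<in> borel_measurable borel"
    by (intro borel_measurable_continuous_onI continuous_intros)
  have meas: "(\<lambda>x. ennreal (max 0 (infdist x S - e) powr p)) \<in> borel_measurable \<mu>" for e
    unfolding measurable_cong_sets[OF \<mu> refl] by measurable
  have "(\<integral>\<^sup>+ x. ennreal (infdist x S powr p) \<partial>\<mu>)
      = (\<integral>\<^sup>+ x. liminf (\<lambda>n. ennreal (max 0 (infdist x S - 1 / real (Suc n)) powr p)) \<partial>\<mu>)"
    by (intro nn_integral_cong lim_imp_Liminf[OF _ lim, symmetric]) simp
  also have "\<dots> \<le> liminf (\<lambda>n. \<integral>\<^sup>+ x. ennreal (max 0 (infdist x S - 1 / real (Suc n)) powr p) \<partial>\<mu>)"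
    by (rule nn_integral_liminf) (rule meas)
  also have "\<dots> \<le> C"
    by (rule Liminf_le) (auto intro!: always_eventually bound)
  finally show ?thesis .
qed

text \<open>The limit curve is rebuilt from the limits of starting point, initial tangent and
  curvature, and cut at the limit length \<open>a\<close>. The length term converges, the curvature
  term can only drop, and the distance term is handled with a slack \<open>e\<close> that is removed
  at the end.\<close>

lemma curve_energy_limit_le:
  fixes \<mu> :: "'a::euclidean_space measure" and c :: "nat \<Rightarrow> real \<times> (real \<Rightarrow> 'a)"
  assumes \<mu>: "sets \<mu> = sets borel" and lam: "lam > 0" and \<epsilon>: "\<epsilon> > 0" and p: "p > 0"
    and c: "\<And>n. c n \<in> arc_curves" "\<And>n. in_H2 (c n)" and A: "\<And>n. fst (c n) \<le> A"
    and a: "(\<lambda>n. fst (c n)) \<longlonglongrightarrow> a"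
    and K: "(\<lambda>n. integral {0..fst (c n)} (\<lambda>t. (norm (curvature (c n) t))\<^sup>2)) \<longlonglongrightarrow> K"
    and x: "(\<lambda>n. snd (c n) 0) \<longlonglongrightarrow> x"
    and I: "(\<lambda>n. curve_energy \<mu> lam \<epsilon> p (c n)) \<longlonglongrightarrow> I"
  shows "\<exists>c'\<in>arc_curves. curve_energy \<mu> lam \<epsilon> p c' \<le> I"
proof -
  define Kn where "Kn n = integral {0..fst (c n)} (\<lambda>t. (norm (curvature (c n) t))\<^sup>2)" for n
  have c0: "0 \<le> fst (c n)" for n using c(1)[of n] by (auto simp: arc_curves_def)
  have a0: "0 \<le> a" using LIMSEQ_le_const[OF a] c0 by blast
  have aA: "a \<le> A" using LIMSEQ_le_const2[OF a] A by blast
  have A0: "0 \<le> A" using a0 aA by simp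
  have "\<forall>n. \<exists>v k. square_integrable (lebesgue_on {0..A}) k \<and>
      integral {0..A} (\<lambda>t. (norm (k t))\<^sup>2) = Kn n \<and>
      (\<forall>t\<in>{0..A}. norm (v + integral {0..t} k) = 1) \<and>
      (\<forall>t\<in>{0..fst (c n)}. snd (c n) t = snd (c n) 0 + integral {0..t} (\<lambda>s. v + integral {0..s} k))"
  proof
    fix n
    show "\<exists>v k. square_integrable (lebesgue_on {0..A}) k \<and>
      integral {0..A} (\<lambda>t. (norm (k t))\<^sup>2) = Kn n \<and>
      (\<forall>t\<in>{0..A}. norm (v + integral {0..t} k) = 1) \<and>
      (\<forall>t\<in>{0..fst (c n)}. snd (c n) t = snd (c n) 0 + integral {0..t} (\<lambda>s. v + integral {0..s} k))"
      using arc_curve_extension[OF c(1)[of n] c(2)[of n] A[of n]] unfolding Kn_def by metis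
  qed
  then obtain v k where k: "\<And>n. square_integrable (lebesgue_on {0..A}) (k n)"
    and kK: "\<And>n. integral {0..A} (\<lambda>t. (norm (k n t))\<^sup>2) = Kn n"
    and unit: "\<And>n t. t \<in> {0..A} \<Longrightarrow> norm (v n + integral {0..t} (k n)) = 1"
    and ceq: "\<And>n t. t \<in> {0..fst (c n)} \<Longrightarrow>
        snd (c n) t = snd (c n) 0 + integral {0..t} (\<lambda>s. v n + integral {0..s} (k n))"
    by metis
  \<comment> \<open>The unit condition at parameter 0 bounds the initial tangents, so they converge
    along a subsequence.\<close>
  have "norm (v n) = 1" for n using unit[of 0 n] A0 by simp
  then have "bounded (range v)" by (auto simp: bounded_iff intro!: exI[of _ 1])
  then obtain w r1 where r1: "strict_mono (r1 :: nat \<Rightarrow> nat)" and w1: "(v \<circ> r1) \<longlonglongrightarrow> w"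
    using bounded_imp_convergent_subsequence by blast
  have lim: "(\<lambda>n. integral {0..A} (\<lambda>t. (norm (k (r1 n) t))\<^sup>2)) \<longlonglongrightarrow> K"
    using LIMSEQ_subseq_LIMSEQ[OF K r1] by (simp add: kK Kn_def o_def)
  obtain r2 h where r2: "strict_mono (r2 :: nat \<Rightarrow> nat)"
    and h: "square_integrable (lebesgue_on {0..A}) h" and hK: "integral {0..A} (\<lambda>t. (norm (h t))\<^sup>2) \<le> K"
    and unif: "\<And>e. e > 0 \<Longrightarrow> \<forall>\<^sub>F n in sequentially. \<forall>t\<in>{0..A}.
        norm (integral {0..t} (k (r1 (r2 n))) - integral {0..t} h) < e"
    by (rule square_integrable_primitives_compact[of A "\<lambda>n. k (r1 n)" K, OF k lim]) (rule that; assumption)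
  define r where "r n = r1 (r2 n)" for n
  have r: "strict_mono r" using r1 r2 by (auto simp: r_def strict_mono_def)
  have w: "(\<lambda>n. v (r n)) \<longlonglongrightarrow> w"
    using LIMSEQ_subseq_LIMSEQ[OF w1 r2] by (simp add: r_def o_def)
  have ar: "(\<lambda>n. fst (c (r n))) \<longlonglongrightarrow> a" and Kr: "(\<lambda>n. Kn (r n)) \<longlonglongrightarrow> K"
    and xr: "(\<lambda>n. snd (c (r n)) 0) \<longlonglongrightarrow> x" and Ir: "(\<lambda>n. curve_energy \<mu> lam \<epsilon> p (c (r n))) \<longlonglongrightarrow> I"
    using LIMSEQ_subseq_LIMSEQ[OF a r] LIMSEQ_subseq_LIMSEQ[OF K r] LIMSEQ_subseq_LIMSEQ[OF x r]
      LIMSEQ_subseq_LIMSEQ[OF I r] by (simp_all add: o_def Kn_def)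
  have hunit: "norm (w + integral {0..t} h) = 1" if t: "t \<in> {0..A}" for t
  proof -
    have "(\<lambda>n. integral {0..t} (k (r n))) \<longlonglongrightarrow> integral {0..t} h"
    proof (rule LIMSEQ_I)
      fix e :: real assume "e > 0"
      from unif[OF this] show "\<exists>N. \<forall>n\<ge>N. norm (integral {0..t} (k (r n)) - integral {0..t} h) < e"
        unfolding eventually_sequentially r_def using t by blast
    qed
    then have "(\<lambda>n. norm (v (r n) + integral {0..t} (k (r n)))) \<longlonglongrightarrow> norm (w + integral {0..t} h)"
      by (intro tendsto_intros w)
    then show ?thesis using unit[OF t] by (simp add: LIMSEQ_const_iff)
  qed
  define \<phi> where "\<phi> = (\<lambda>t. x + integral {0..t} (\<lambda>s. w + integral {0..s} h))"
  \<comment> \<open>The extension of the curve \<open>c (r n)\<close> to \<open>[0,A]\<close>; the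
    two agree up to the length of that curve.\<close>
  define \<phi>n where "\<phi>n n = (\<lambda>t. snd (c (r n)) 0 + integral {0..t} (\<lambda>s. v (r n) + integral {0..s} (k (r n))))" for n
  have lip: "1-lipschitz_on {0..A} \<phi>"
    using arc_curve_of_curvature(4)[OF A0 h hunit] unfolding \<phi>_def by simp
  have sub: "{0..a} \<subseteq> {0..A}" using aA by auto
  have ha: "square_integrable (lebesgue_on {0..a}) h"
    by (rule square_integrable_subinterval(1)[OF h sub])
  have haK: "integral {0..a} (\<lambda>t. (norm (h t))\<^sup>2) \<le> K"
    using square_integrable_subinterval(2)[OF h sub] hK by simp
  have hunita: "norm (w + integral {0..t} h) = 1" if "t \<in> {0..a}" for t
    using hunit that sub by blast
  note curve = arc_curve_of_curvature[OF a0 ha hunita, where x = x, folded \<phi>_def]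
  have conti: "continuous_on {0..A} (\<lambda>s. u + integral {0..s} f)"
    if "square_integrable (lebesgue_on {0..A}) f" for u :: 'a and f
    using that by (intro continuous_intros indefinite_integral_continuous_1)
      (auto simp: square_integrable_lebesgue_on_iff absolutely_integrable_on_def)
  have close: "\<forall>\<^sub>F n in sequentially. \<forall>t\<in>{0..A}. dist (\<phi> t) (\<phi>n n t) \<le> e" if e: "e > 0" for e
  proof -
    \<comment> \<open>The starting points contribute \<open>d\<close> and the tangents at most
      \<open>2 * d\<close> over a length at most \<open>A\<close>, in total
      \<open>d * (1 + 2 * A) = e\<close>.\<close>
    define d where "d = e / (1 + 2 * A)"
    have d: "d > 0" using e A0 by (simp add: d_def)
    have "\<forall>\<^sub>F n in sequentially. dist (snd (c (r n)) 0) x < d" "\<forall>\<^sub>F n in sequentially. dist (v (r n)) w < d"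
      using tendstoD[OF xr d] tendstoD[OF w d] by auto
    with unif[OF d] show ?thesis
    proof eventually_elim
      case (elim n)
      show ?case
      proof
        fix t assume t: "t \<in> {0..A}"
        have i1: "(\<lambda>s. w + integral {0..s} h) integrable_on {0..t}"
          using continuous_on_subset[OF conti[OF h]] t by (intro integrable_continuous_real) auto
        have i2: "(\<lambda>s. v (r n) + integral {0..s} (k (r n))) integrable_on {0..t}"
          using continuous_on_subset[OF conti[OF k]] t by (intro integrable_continuous_real) auto
        let ?g = "\<lambda>s. (w + integral {0..s} h) - (v (r n) + integral {0..s} (k (r n)))"
        have "norm (integral {0..t} ?g) \<le> integral {0..t} (\<lambda>s. 2 * d)"
        proof (rule integral_norm_bound_integral)
          show "?g integrable_on {0..t}" using i1 i2 by (rule integrable_diff)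
          show "norm (?g s) \<le> 2 * d" if "s \<in> {0..t}" for s
          proof -
            have "norm (integral {0..s} (k (r n)) - integral {0..s} h) < d" "norm (v (r n) - w) < d"
              using elim that t by (auto simp: dist_norm r_def)
            moreover have eq: "?g s = - ((v (r n) - w) + (integral {0..s} (k (r n)) - integral {0..s} h))"
              by simp
            ultimately show ?thesis
              unfolding eq norm_minus_cancel
              using norm_triangle_ineq[of "v (r n) - w" "integral {0..s} (k (r n)) - integral {0..s} h"]
              by linarith
          qed
        qed auto
        also have "\<dots> \<le> 2 * d * A" using t d by simp
        finally have g: "norm (integral {0..t} ?g) \<le> 2 * d * A" .
        have eq: "\<phi> t - \<phi>n n t = (x - snd (c (r n)) 0) + integral {0..t} ?g"
          unfolding \<phi>_def \<phi>n_def Henstock_Kurzweil_Integration.integral_diff[OF i1 i2] by simp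
        have "dist (\<phi> t) (\<phi>n n t) \<le> norm (x - snd (c (r n)) 0) + norm (integral {0..t} ?g)"
          unfolding dist_norm eq by (rule norm_triangle_ineq)
        also have "\<dots> \<le> d + 2 * d * A"
          using elim(2) g by (intro add_mono) (auto simp: dist_norm norm_minus_commute)
        also have "\<dots> = d * (1 + 2 * A)" by (simp add: algebra_simps)
        also have "\<dots> = e" using A0 by (simp add: d_def)
        finally show "dist (\<phi> t) (\<phi>n n t) \<le> e" .
      qed
    qed
  qed
  have image: "curve_image (c (r n)) = \<phi>n n ` {0..fst (c (r n))}" for n
    unfolding curve_image_def \<phi>n_def by (rule image_cong[OF refl]) (rule ceq)
  have En: "curve_energy \<mu> lam \<epsilon> p (c (r n)) = (\<integral>\<^sup>+ y. ennreal (infdist y (curve_image (c (r n))) powr p) \<partial>\<mu>)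
      + ennreal (lam * fst (c (r n))) + ennreal (\<epsilon> * Kn (r n))" for n
    using c by (simp add: curve_energy_def curve_length_def Kn_def)
  define L where "L = ennreal (lam * a) + ennreal (\<epsilon> * K)"
  \<comment> \<open>For fixed \<open>e\<close> the reduced distance term is constant in
    \<open>n\<close>. It lies below the true one as soon as the extended curves are uniformly
    \<open>e / 2\<close>-close and the lengths differ by less than \<open>e / 2\<close>.\<close>
  have step: "(\<integral>\<^sup>+ y. ennreal (max 0 (infdist y (\<phi> ` {0..a}) - e) powr p) \<partial>\<mu>) + L \<le> I" (is "?D + L \<le> I")
    if e: "e > 0" for e
  proof (rule LIMSEQ_le)
    show "(\<lambda>n. ?D + (ennreal (lam * fst (c (r n))) + ennreal (\<epsilon> * Kn (r n)))) \<longlonglongrightarrow> ?D + L"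
      unfolding L_def by (intro tendsto_intros tendsto_ennrealI ar Kr)
    have "\<forall>\<^sub>F n in sequentially. dist (fst (c (r n))) a < e / 2"
      using tendstoD[OF ar, of "e/2"] e by simp
    with close[OF half_gt_zero[OF e]]
    have "\<forall>\<^sub>F n in sequentially. ?D + (ennreal (lam * fst (c (r n))) + ennreal (\<epsilon> * Kn (r n)))
       \<le> curve_energy \<mu> lam \<epsilon> p (c (r n))"
    proof eventually_elim
      case (elim n)
      have "max 0 (infdist y (\<phi> ` {0..a}) - e) \<le> infdist y (curve_image (c (r n)))" for y
      proof -
        have "infdist y (\<phi> ` {0..a}) \<le> infdist y (\<phi>n n ` {0..fst (c (r n))}) + (e / 2 + \<bar>a - fst (c (r n))\<bar>)"
          by (rule infdist_image_perturb[OF lip]) (use elim a0 aA A c0 in auto)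
        then show ?thesis
          using elim(2) infdist_nonneg[of y "\<phi>n n ` {0..fst (c (r n))}"]
          unfolding image dist_real_def by (intro max.boundedI) linarith+
      qed
      then have "?D \<le> (\<integral>\<^sup>+ y. ennreal (infdist y (curve_image (c (r n))) powr p) \<partial>\<mu>)"
        using p by (intro nn_integral_mono ennreal_leI powr_mono2) auto
      then show ?case unfolding En by (simp add: add.assoc add_right_mono)
    qed
    then show "\<exists>N. \<forall>n\<ge>N. ?D + (ennreal (lam * fst (c (r n))) + ennreal (\<epsilon> * Kn (r n)))
       \<le> curve_energy \<mu> lam \<epsilon> p (c (r n))"
      by (simp add: eventually_sequentially)
  qed (rule Ir)
  have "(\<integral>\<^sup>+ y. ennreal (infdist y (\<phi> ` {0..a}) powr p) \<partial>\<mu>) \<le> I - L"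
    by (rule nn_integral_infdist_powr_limit[OF \<mu> p]) (use step in \<open>auto simp: ennreal_le_minus_iff\<close>)
  \<comment> \<open>Subtraction in \<open>ennreal\<close> is truncated at 0, so this inequality is
    what allows \<open>L\<close> to be moved back to the left.\<close>
  moreover have "L \<le> I"
    using step[of 1] order_trans[OF add_increasing[OF zero_le order_refl]] by auto
  ultimately have fin: "(\<integral>\<^sup>+ y. ennreal (infdist y (\<phi> ` {0..a}) powr p) \<partial>\<mu>) + L \<le> I"
    by (auto simp: ennreal_le_minus_iff)
  have "curve_energy \<mu> lam \<epsilon> p (a, \<phi>) = (\<integral>\<^sup>+ y. ennreal (infdist y (\<phi> ` {0..a}) powr p) \<partial>\<mu>)
      + ennreal (lam * a) + ennreal (\<epsilon> * integral {0..a} (\<lambda>t. (norm (h t))\<^sup>2))"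
    using curve(1-3) by (simp add: curve_energy_def curve_length_def curve_image_def)
  also have "\<dots> \<le> (\<integral>\<^sup>+ y. ennreal (infdist y (\<phi> ` {0..a}) powr p) \<partial>\<mu>) + ennreal (lam * a) + ennreal (\<epsilon> * K)"
    using haK \<epsilon> by (intro add_left_mono ennreal_leI mult_left_mono) auto
  also have "\<dots> \<le> I" using fin by (simp add: L_def add.assoc)
  finally show ?thesis using curve(1) by blast
qed

section \<open>Bounds along a minimizing sequence and existence of a minimizer\<close>

text \<open>Within a one-point interval every vector is a derivative, in particular a unit vector.
  Point curves show that the admissible class is nonempty and settle the degenerate cases.\<close>

lemma point_curve:
  "(0, \<lambda>_. x) \<in> arc_curves" "in_H2 (0, \<lambda>_. x)"
proof -
  have "\<exists>v. ((\<lambda>_. x) has_vector_derivative v) (at t within {0..0}) \<and> norm v = 1" if "t \<in> {0..0}" for t :: real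
  proof -
    obtain b :: 'a where b: "b \<in> Basis" using nonempty_Basis by blast
    have "((\<lambda>_. x) has_vector_derivative b) (at t within {0..0})"
      using that by (simp add: has_vector_derivative_def has_derivative_within_singleton_iff
          bounded_linear_scaleR_left)
    then show ?thesis using b by auto
  qed
  then have "AE t in lborel. t \<in> {0..0} \<longrightarrow>
      (\<exists>v. ((\<lambda>_. x) has_vector_derivative v) (at t within {0..0::real}) \<and> norm v = 1)"
    by (intro AE_I2) blast
  moreover have "0-lipschitz_on {0..0::real} (\<lambda>_. x)"
    by (rule lipschitz_onI) auto
  ultimately show "(0, \<lambda>_. x) \<in> arc_curves"
    unfolding arc_curves_def mem_Collect_eq prod.case by blast
  show "in_H2 (0, \<lambda>_. x)"
    by (auto simp: in_H2_def weak_second_deriv_def intro!: exI[of _ "\<lambda>_. 0"] integrable_0)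
qed

text \<open>The curve stays within \<open>A\<close> of its starting point. If that point is far from
  the ball of radius \<open>\<rho>\<close>, almost every \<open>y\<close> is at distance at least
  \<open>m\<close> from the curve, and the distance term is at least \<open>m powr p\<close> times
  the total mass.\<close>

lemma curve_start_bounded:
  fixes \<mu> :: "'a::euclidean_space measure"
  assumes \<mu>: "sets \<mu> = sets borel" "finite_measure \<mu>" and pos: "measure \<mu> (space \<mu>) > 0"
    and K: "AE y in \<mu>. norm y \<le> \<rho>" and p: "p \<ge> 1"
    and c: "c \<in> arc_curves" "in_H2 c" "fst c \<le> A"
    and R: "(\<integral>\<^sup>+ y. ennreal (infdist y (curve_image c) powr p) \<partial>\<mu>) \<le> ennreal R" "R \<ge> 0"
  shows "norm (snd c 0) \<le> \<rho> + A + max 1 (R / measure \<mu> (space \<mu>))"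
proof -
  interpret finite_measure \<mu> by fact
  define m where "m = max 0 (norm (snd c 0) - \<rho> - A)"
  have c0: "0 \<le> fst c" using c(1) by (auto simp: arc_curves_def)
  have le: "m \<le> infdist y (curve_image c)" if y: "norm y \<le> \<rho>" for y
  proof -
    have "norm (snd c 0) - \<rho> - A \<le> dist y (snd c t)" if t: "t \<in> {0..fst c}" for t
    proof -
      have "dist (snd c 0) (snd c t) \<le> A"
        using lipschitz_onD[OF arc_curve_lipschitz[OF c(1,2)], of 0 t] t c(3) by (auto simp: dist_real_def)
      moreover have "norm (snd c 0) \<le> dist (snd c 0) (snd c t) + dist y (snd c t) + norm y"
        using dist_triangle[of "snd c 0" 0 "snd c t"] dist_triangle[of "snd c t" 0 y]
        by (simp add: dist_commute)
      ultimately show ?thesis using y by linarith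
    qed
    then have "norm (snd c 0) - \<rho> - A \<le> infdist y (curve_image c)"
      using c0 by (auto simp: infdist_def curve_image_def intro!: cINF_greatest)
    then show ?thesis by (simp add: m_def infdist_nonneg)
  qed
  have "ennreal (m powr p * measure \<mu> (space \<mu>)) = (\<integral>\<^sup>+ y. ennreal (m powr p) \<partial>\<mu>)"
    by (simp add: emeasure_eq_measure ennreal_mult)
  also have "\<dots> \<le> (\<integral>\<^sup>+ y. ennreal (infdist y (curve_image c) powr p) \<partial>\<mu>)"
  proof (rule nn_integral_mono_AE)
    show "AE y in \<mu>. ennreal (m powr p) \<le> ennreal (infdist y (curve_image c) powr p)"
      using K
    proof eventually_elim
      case (elim y)
      show ?case using le[OF elim] p by (intro ennreal_leI powr_mono2) (auto simp: m_def)
    qed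
  qed
  also have "\<dots> \<le> ennreal R" by fact
  finally have "m powr p * measure \<mu> (space \<mu>) \<le> R" using R(2) by simp
  then have "m powr p \<le> R / measure \<mu> (space \<mu>)" using pos by (simp add: field_simps)
  \<comment> \<open>As \<open>p \<ge> 1\<close>, this avoids taking a p-th root: either
    \<open>m < 1\<close>, or \<open>m\<close> is at most its p-th power.\<close>
  moreover have "m \<le> max 1 (m powr p)"
    using powr_mono[of 1 p m] p by (cases "m \<ge> 1") auto
  ultimately have "m \<le> max 1 (R / measure \<mu> (space \<mu>))" by linarith
  then show ?thesis by (simp add: m_def)
qed

theorem theorem2p4:
  fixes \<mu> :: "'a::euclidean_space measure" and lam \<epsilon> p :: real
  assumes "DIM('a) \<ge> 2"
    and "sets \<mu> = sets borel"
    and "finite_measure \<mu>"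
    and "\<exists>K. compact K \<and> emeasure \<mu> (UNIV - K) = 0"
    and "lam > 0" and "\<epsilon> > 0" and "p \<ge> 1"
  shows "\<exists>c\<in>arc_curves. \<forall>c'\<in>arc_curves. curve_energy \<mu> lam \<epsilon> p c \<le> curve_energy \<mu> lam \<epsilon> p c'"
proof -
  interpret finite_measure \<mu> by fact
  define E where "E = curve_energy \<mu> lam \<epsilon> p"
  define I where "I = Inf (E ` arc_curves)"
  have lower: "I \<le> E c" if "c \<in> arc_curves" for c
    unfolding I_def using that by (rule INF_lower)
  have "\<exists>c\<in>arc_curves. E c \<le> I"
  \<comment> \<open>With zero mass the energy gives no control on starting points, and with an
    infinite infimum every curve is minimal; the point curve at the origin serves both
    cases.\<close>
  proof (cases "I = \<top> \<or> measure \<mu> (space \<mu>) = 0")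
    case True
    have "E (0, \<lambda>_. 0) \<le> I"
    proof (cases "I = \<top>")
      case False
      then have "emeasure \<mu> (space \<mu>) = 0" using True by (simp add: emeasure_eq_measure)
      then have null: "AE y in \<mu>. False" by (auto simp: AE_iff_measurable[OF sets.top])
      have zero: "(\<integral>\<^sup>+ y. f y \<partial>\<mu>) = 0" for f :: "'a \<Rightarrow> ennreal"
      proof -
        have "AE y in \<mu>. f y = 0" using null by eventually_elim simp
        then show ?thesis by (subst nn_integral_cong_AE[where v = "\<lambda>_. 0"]) auto
      qed
      have "E (0, \<lambda>_. 0) = 0"
        using point_curve[of "0::'a"] by (simp add: E_def curve_energy_def curve_length_def zero)
      then show ?thesis by simp
    qed simp
    then show ?thesis using point_curve(1) by blast
  next
    case False
    then have pos: "measure \<mu> (space \<mu>) > 0" and Itop: "I < \<top>"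
      by (simp_all add: zero_less_measure_iff less_top[symmetric])
    have ne: "E ` arc_curves \<noteq> {}" using point_curve(1) by blast
    obtain c0 where c0: "\<And>n. c0 n \<in> arc_curves" and lim0: "(\<lambda>n. E (c0 n)) \<longlonglongrightarrow> I"
    proof -
      obtain u where u: "\<And>n. u n \<in> E ` arc_curves" "u \<longlonglongrightarrow> I"
        using Inf_as_limit[OF ne] unfolding I_def by blast
      then have "\<forall>n. \<exists>c. c \<in> arc_curves \<and> u n = E c" by blast
      then obtain c where c: "\<And>n. c n \<in> arc_curves" "\<And>n. u n = E (c n)" by metis
      then have "u = (\<lambda>n. E (c n))" by blast
      then show ?thesis using that[OF c(1)] u(2) by simp
    qed
    \<comment> \<open>Dropping the first \<open>N\<close> terms puts every energy below the finite
      value \<open>I + 1\<close>, so the bounds derived from it hold for all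
      \<open>n\<close>.\<close>
    have "I < I + 1" using Itop by (cases I) (auto simp flip: ennreal_plus ennreal_1 simp: ennreal_less_iff)
    then obtain N where N: "\<And>n. n \<ge> N \<Longrightarrow> E (c0 n) < I + 1"
      using order_tendstoD(2)[OF lim0] unfolding eventually_sequentially by blast
    define c where "c n = c0 (n + N)" for n
    have c: "c n \<in> arc_curves" for n using c0 by (simp add: c_def)
    have lim: "(\<lambda>n. E (c n)) \<longlonglongrightarrow> I"
      unfolding c_def by (rule LIMSEQ_ignore_initial_segment[OF lim0])
    obtain R where R: "R \<ge> 0" "I + 1 = ennreal R"
      using Itop by (cases "I + 1") (auto simp: ennreal_add_eq_top)
    have ER: "E (c n) \<le> ennreal R" for n using N[of "n + N"] R by (simp add: c_def)
    have H: "in_H2 (c n)" for n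
      using ER[of n] by (auto simp: E_def curve_energy_def top_unique split: if_splits)
    define D where "D n = (\<integral>\<^sup>+ y. ennreal (infdist y (curve_image (c n)) powr p) \<partial>\<mu>)" for n
    define K where "K n = integral {0..fst (c n)} (\<lambda>t. (norm (curvature (c n) t))\<^sup>2)" for n
    have E: "E (c n) = D n + ennreal (lam * fst (c n)) + ennreal (\<epsilon> * K n)" for n
      using c[of n] H[of n] by (simp add: E_def curve_energy_def curve_length_def D_def K_def)
    have DR: "D n \<le> ennreal R" for n
      using order_trans[OF _ ER[of n], of "D n"] unfolding E by (simp add: add.assoc)
    have aR: "fst (c n) \<le> R / lam" for n
    proof -
      have "ennreal (lam * fst (c n)) \<le> ennreal R"
        by (rule order_trans[OF _ ER[of n]]) (simp add: E add.assoc add.left_commute[of _ "ennreal (lam * fst (c n))"])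
      then show ?thesis using R \<open>lam > 0\<close> by (simp add: field_simps)
    qed
    have KR: "K n \<le> R / \<epsilon>" for n
    proof -
      have "ennreal (\<epsilon> * K n) \<le> ennreal R"
        by (rule order_trans[OF _ ER[of n]]) (simp add: E add.commute[of _ "ennreal (\<epsilon> * K n)"])
      then show ?thesis using R \<open>\<epsilon> > 0\<close> by (simp add: field_simps)
    qed
    have a0: "0 \<le> fst (c n)" for n using c[of n] by (auto simp: arc_curves_def)
    \<comment> \<open>If the integrand were not integrable, \<open>integral\<close> would have its
      default value 0, so the sign holds in either case.\<close>
    have K0: "0 \<le> K n" for n
    proof (cases "(\<lambda>t. (norm (curvature (c n) t))\<^sup>2) integrable_on {0..fst (c n)}")
      case True
      then show ?thesis unfolding K_def by (rule Henstock_Kurzweil_Integration.integral_nonneg) simp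
    qed (simp add: K_def not_integrable_integral)
    obtain C where C: "compact C" "emeasure \<mu> (UNIV - C) = 0" using assms(4) by blast
    obtain \<rho> where \<rho>: "\<And>y. y \<in> C \<Longrightarrow> norm y \<le> \<rho>"
      using compact_imp_bounded[OF C(1)] by (auto simp: bounded_iff)
    have "AE y in \<mu>. norm y \<le> \<rho>"
    proof (rule AE_I)
      show "UNIV - C \<in> sets \<mu>" using C(1) by (simp add: assms(2) compact_imp_closed borel_open open_Diff)
    qed (use C \<rho> in auto)
    then have xR: "norm (snd (c n) 0) \<le> \<rho> + R / lam + max 1 (R / measure \<mu> (space \<mu>))" for n
      by (rule curve_start_bounded[OF assms(2,3) pos _ assms(7) c H aR DR[unfolded D_def] R(1)])
    \<comment> \<open>Lengths, curvature terms and starting points are bundled into one vector, so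
      that a single subsequence makes all three converge.\<close>
    have "bounded (range (\<lambda>n. (fst (c n), K n, snd (c n) 0)))"
    proof (rule bounded_subset)
      show "bounded ({0..R / lam} \<times> {0..R / \<epsilon>} \<times> cball 0 (\<rho> + R / lam + max 1 (R / measure \<mu> (space \<mu>))))"
        by (intro bounded_Times bounded_closed_interval bounded_cball)
    qed (use a0 aR K0 KR xR in auto)
    then obtain l r where r: "strict_mono (r :: nat \<Rightarrow> nat)"
      and l: "((\<lambda>n. (fst (c n), K n, snd (c n) 0)) \<circ> r) \<longlonglongrightarrow> l"
      using bounded_imp_convergent_subsequence by blast
    have "(\<lambda>n. fst (c (r n))) \<longlonglongrightarrow> fst l" "(\<lambda>n. K (r n)) \<longlonglongrightarrow> fst (snd l)"
      "(\<lambda>n. snd (c (r n)) 0) \<longlonglongrightarrow> snd (snd l)"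
      using tendsto_fst[OF l] tendsto_fst[OF tendsto_snd[OF l]] tendsto_snd[OF tendsto_snd[OF l]]
      by (simp_all add: o_def)
    moreover have "(\<lambda>n. E (c (r n))) \<longlonglongrightarrow> I"
      using LIMSEQ_subseq_LIMSEQ[OF lim r] by (simp add: o_def)
    ultimately show ?thesis
      unfolding E_def K_def using assms(7)
      by (intro curve_energy_limit_le[OF assms(2,5,6) _ c H aR]) auto
  qed
  then show ?thesis
    using lower order_trans unfolding E_def by blast
qed

end
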